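(* Let $m\in\mathbb{N}$, $m\ge1$, $0<p\le\infty$, and let $f:\square_m\to\mathbb{R}$ be a Bos--Levenberg--Trefethen (BLT) function with approximation rate $$\|f-p_n^*\|_{C^0(\square_m)}\lesssim\rho^{-n},\qquad \rho=\rho_p>1,$$ where $p_n^*\in\Pi_{m,n,p}$ denotes a best approximation of $f$ in $\Pi_{m,n,p}$ with respect to $\|\cdot\|_{C^0(\square_m)}$. Let $\theta\ge1$ and, for each $n\in\mathbb{N}$, let $A=A_{m,n,p}$ and let $P_A=\{(p_{\alpha_1,1},\dots,p_{\alpha_m,m}):\alpha\in A\}\subseteq\square_m$ be generated by sets $P_i=\{p_{0,i},\dots,p_{n,i}\}\subseteq[-1,1]$ of $n+1$ distinct points, $i=1,\dots,m$ (which may depend on $n$), such that the univariate Lebesgue constants of the truncations $P_{i,h}=\{p_{0,i},\dots,p_{h,i}\}$ satisfy $\Lambda(P_{i,h})\le(n+1)^\theta$ for all $0\le h\le n$ and all $i=1,\dots,m$. Let $Q_{f,P_A}\in\Pi_A$ be the unique polynomial interpolating $f$ in $P_A$. Then: (i) The approximation error of the interpolant is bounded by $$\|f-Q_{f,P_A}\|_{C^0(\square_m)}\lesssim(1+\Lambda(P_A))\,\rho^{-n}=\mathcal{O}_\varepsilon(\rho^{-n}).$$ (ii) For any order $k\in\mathbb{N}$, the derivatives of the interpolants approximate the derivatives of $f$ with $$\|f-Q_{f,P_A}\|_{C^k(\square_m)}\lesssim(1+\Lambda(P_A)_k)\,\rho^{-n}=\mathcal{O}_\varepsilon(\rho^{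-n}).$$
   Context: $\mathbb{N}$ includes $0$; $\square_m=[-1,1]^m$. $A_{m,n,p}=\{\alpha\in\mathbb{N}^m:\|\alpha\|_p\le n\}$ and $\Pi_{m,n,p}=\Pi_{A_{m,n,p}}$, where $\Pi_A=\mathrm{span}\{x^\alpha:\alpha\in A\}$. $\|f\|_{C^0(\square_m)}=\sup_{x\in\square_m}|f(x)|$ and $\|f\|_{C^k(\square_m)}=\sum_{\beta\in\mathbb{N}^m,\ \|\beta\|_1\le k}\|\partial_\beta f\|_{C^0(\square_m)}$, with $\partial_\beta=\partial_{x_1}^{\beta_1}\cdots\partial_{x_m}^{\beta_m}$. BLT functions: let $P_p=\{x\in[0,\infty)^m:\|x\|_p\le1\}$, so that $\Pi(nP_p)=\mathrm{span}\{z^\alpha:\alpha\in nP_p\cap\mathbb{N}^m\}=\Pi_{m,n,p}$ (with complex coefficients in what follows). For compact $K\subseteq\mathbb{C}^m$ (here $K=\square_m$) put $V_{P,K}(z)=\lim_{n\to\infty}\sup\{\tfrac1n\log|q(z)|:q\in\Pi(nP),\ \|q\|_{C^0(K)}\le1\}$ and $\Omega_\rho(P,K)=\{z\in\mathbb{C}^m:V_{P,K}(z)<\log\rho\}$. A continuous function on $K$ is a BLT function if it is the restriction to $K$ of a function holomorphic in $\Omega_\rho(P,K)$ for some $\rho>1$; here $P=P_p$. Lebesgue constants: for distinct univariate nodes $q_0,\dots,q_h\in[-1,1]$, $\Lambda(\{q_0,\dots,q_h\})=\sup_{x\in[-1,1]}\sum_{j=0}^h|l_j(x)|$ with $l_j$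 the univariate Lagrange polynomials. For $P_A=\{p_\alpha\}_{\alpha\in A}$ let $L_\alpha\in\Pi_A$ be the Lagrange polynomials, $L_\alpha(p_\beta)=\delta_{\alpha,\beta}$. Then $\Lambda(P_A)=\sup_{x\in\square_m}\sum_{\alpha\in A}|L_\alpha(x)|$ and $\Lambda(P_A)_k=\sum_{\beta\in\mathbb{N}^m,\,\|\beta\|_1\le k}\ \sup_{x\in\square_m}\sum_{\alpha\in A}|\partial_\beta L_\alpha(x)|$. Asymptotics are for $n\to\infty$ with $m,p,f,\rho,\theta,k$ fixed: $a_n\lesssim b_n$ means $a_n\le Cb_n$ with $C$ independent of $n$; $g_n=\mathcal{O}_\varepsilon(\rho^{-n})$ means $g_n=\mathcal{O}((\rho-\varepsilon)^{-n})$ for every $0<\varepsilon<\rho$. *)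

theory Defs
  imports "HOL-Analysis.Analysis" "HOL-Library.Landau_Symbols"
begin

text \<open>The dimension \<open>m\<close> is the cardinality of a finite index type \<open>'m\<close>; where an order of the
  coordinates matters (iterated partial derivatives), \<open>'m\<close> is linearly ordered.
  Multi-indices are elements of \<open>nat ^ 'm\<close>.\<close>

definition cube :: "(real ^ 'm) set"
  where "cube = {x. \<forall>i. x $ i \<in> {-1..1}}"

definition sup_norm :: "'a set \<Rightarrow> ('a \<Rightarrow> 'b::real_normed_vector) \<Rightarrow> real"
  where "sup_norm K f = (SUP x\<in>K. norm (f x))"

definition lp_norm :: "ereal \<Rightarrow> real ^ 'm \<Rightarrow> real"
  where "lp_norm p x =
    (if p = \<infinity> then Max (range (\<lambda>i. \<bar>x $ i\<bar>))
     else (\<Sum>i\<in>UNIV. \<bar>x $ i\<bar> powr real_of_ereal p) powr (1 / real_of_ereal p))"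

definition index_set :: "nat \<Rightarrow> ereal \<Rightarrow> (nat ^ 'm) set"
  where "index_set n p = {\<alpha>. lp_norm p (\<chi> i. real (\<alpha> $ i)) \<le> real n}"

text \<open>The span of the monomials with exponents in a finite set \<open>A\<close>, as polynomial functions.\<close>

definition poly_space :: "(nat ^ 'm) set \<Rightarrow> ('a::comm_ring_1 ^ 'm \<Rightarrow> 'a) set"
  where "poly_space A = {q. \<exists>c. q = (\<lambda>x. \<Sum>\<alpha>\<in>A. c \<alpha> * (\<Prod>i\<in>UNIV. (x $ i) ^ (\<alpha> $ i)))}"

subsection \<open>Partial derivatives on the cube\<close>

text \<open>Derivatives are taken along the coordinate lines within \<open>[-1,1]\<close>, hence one-sidedly on the
  faces, so that they depend only on the values of the function on the cube.\<close>

definition coord_line :: "'m \<Rightarrow> (real ^ 'm \<Rightarrow> real) \<Rightarrow> real ^ 'm \<Rightarrow> real \<Rightarrow> real"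
  where "coord_line i f x t = f (\<chi> j. if j = i then t else x $ j)"

definition partial :: "'m \<Rightarrow> (real ^ 'm \<Rightarrow> real) \<Rightarrow> real ^ 'm \<Rightarrow> real"
  where "partial i f x = vector_derivative (coord_line i f x) (at (x $ i) within {-1..1})"

definition mpartial :: "nat ^ 'm::{finite,linorder} \<Rightarrow> (real ^ 'm::{finite,linorder} \<Rightarrow> real) \<Rightarrow> real ^ 'm::{finite,linorder} \<Rightarrow> real"
  where "mpartial \<beta> f = foldr (\<lambda>i. partial i ^^ (\<beta> $ i)) (sorted_list_of_set UNIV) f"

primrec Ck_on_cube :: "nat \<Rightarrow> (real ^ 'm \<Rightarrow> real) \<Rightarrow> bool"
  where
    "Ck_on_cube 0 f \<longleftrightarrow> continuous_on cube f"
  | "Ck_on_cube (Suc k) f \<longleftrightarrow> continuous_on cube f \<and>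
       (\<forall>i. (\<forall>x\<in>cube. coord_line i f x differentiable (at (x $ i) within {-1..1})) \<and>
            Ck_on_cube k (partial i f))"

definition Ck_norm :: "nat \<Rightarrow> (real ^ 'm::{finite,linorder} \<Rightarrow> real) \<Rightarrow> real"
  where "Ck_norm k f = (\<Sum>\<beta> | (\<Sum>i\<in>UNIV. \<beta> $ i) \<le> k. sup_norm cube (mpartial \<beta> f))"

subsection \<open>Bos--Levenberg--Trefethen functions\<close>

definition lp_body :: "ereal \<Rightarrow> (real ^ 'm) set"
  where "lp_body p = {x. (\<forall>i. 0 \<le> x $ i) \<and> lp_norm p x \<le> 1}"

definition dilate_indices :: "nat \<Rightarrow> (real ^ 'm) set \<Rightarrow> (nat ^ 'm) set"
  where "dilate_indices n P = {\<alpha>. (\<chi> i. real (\<alpha> $ i)) \<in> (\<lambda>x. real n *\<^sub>R x) ` P}"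

definition extremal_fun :: "(real ^ 'm) set \<Rightarrow> (complex ^ 'm) set \<Rightarrow> complex ^ 'm \<Rightarrow> ereal"
  where "extremal_fun P K z =
    lim (\<lambda>n. SUP q \<in> {q \<in> poly_space (dilate_indices n P). sup_norm K q \<le> 1}.
           (if q z = 0 then -\<infinity> else ereal (ln (norm (q z)) / real n)))"

definition Omega :: "real \<Rightarrow> (real ^ 'm) set \<Rightarrow> (complex ^ 'm) set \<Rightarrow> (complex ^ 'm) set"
  where "Omega \<rho> P K = {z. extremal_fun P K z < ereal (ln \<rho>)}"

text \<open>Holomorphy in several variables: the Frechet derivative exists and is complex linear.\<close>

definition mholomorphic_on :: "(complex ^ 'm \<Rightarrow> complex) \<Rightarrow> (complex ^ 'm) set \<Rightarrow> bool"
  where "mholomorphic_on F S \<longleftrightarrow>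
    (\<forall>z\<in>S. \<exists>D. (F has_derivative D) (at z) \<and> (\<forall>c v. D (c *s v) = c * D v))"

definition of_real_vec :: "real ^ 'm \<Rightarrow> complex ^ 'm"
  where "of_real_vec x = (\<chi> i. complex_of_real (x $ i))"

definition BLT_function :: "ereal \<Rightarrow> (real ^ 'm \<Rightarrow> real) \<Rightarrow> bool"
  where "BLT_function p f \<longleftrightarrow> continuous_on cube f \<and>
    (\<exists>R>1. \<exists>F. mholomorphic_on F (Omega R (lp_body p) (of_real_vec ` cube)) \<and>
       (\<forall>x\<in>cube. F (of_real_vec x) = complex_of_real (f x)))"

definition best_approx :: "(nat ^ 'm) set \<Rightarrow> (real ^ 'm \<Rightarrow> real) \<Rightarrow> (real ^ 'm \<Rightarrow> real) \<Rightarrow> bool"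
  where "best_approx A f q \<longleftrightarrow> q \<in> poly_space A \<and>
    (\<forall>r\<in>poly_space A. sup_norm cube (\<lambda>x. f x - q x) \<le> sup_norm cube (\<lambda>x. f x - r x))"

subsection \<open>Interpolation and Lebesgue constants\<close>

definition lagrange1 :: "(nat \<Rightarrow> real) \<Rightarrow> nat \<Rightarrow> nat \<Rightarrow> real \<Rightarrow> real"
  where "lagrange1 q h j x = (\<Prod>i\<in>{..h} - {j}. (x - q i) / (q j - q i))"

text \<open>The univariate Lebesgue constant of the truncation \<open>{q 0, ..., q h}\<close>.\<close>

definition lebesgue_const1 :: "(nat \<Rightarrow> real) \<Rightarrow> nat \<Rightarrow> real"
  where "lebesgue_const1 q h = (SUP x\<in>{-1..1}. \<Sum>j\<le>h. \<bar>lagrange1 q h j x\<bar>)"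

text \<open>\<open>P i j\<close> is the \<open>j\<close>-th node of the \<open>i\<close>-th coordinate.\<close>

definition grid_node :: "('m \<Rightarrow> nat \<Rightarrow> real) \<Rightarrow> nat ^ 'm \<Rightarrow> real ^ 'm"
  where "grid_node P \<alpha> = (\<chi> i. P i (\<alpha> $ i))"

definition interpolant ::
    "(nat ^ 'm) set \<Rightarrow> ('m \<Rightarrow> nat \<Rightarrow> real) \<Rightarrow> (real ^ 'm \<Rightarrow> real) \<Rightarrow> real ^ 'm \<Rightarrow> real"
  where "interpolant A P f =
    (THE q. q \<in> poly_space A \<and> (\<forall>\<alpha>\<in>A. q (grid_node P \<alpha>) = f (grid_node P \<alpha>)))"

definition lagrange ::
    "(nat ^ 'm) set \<Rightarrow> ('m \<Rightarrow> nat \<Rightarrow> real) \<Rightarrow> nat ^ 'm \<Rightarrow> real ^ 'm \<Rightarrow> real"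
  where "lagrange A P \<alpha> =
    (THE q. q \<in> poly_space A \<and> (\<forall>\<beta>\<in>A. q (grid_node P \<beta>) = (if \<alpha> = \<beta> then 1 else 0)))"

definition lebesgue_const :: "(nat ^ 'm) set \<Rightarrow> ('m \<Rightarrow> nat \<Rightarrow> real) \<Rightarrow> real"
  where "lebesgue_const A P = (SUP x\<in>cube. \<Sum>\<alpha>\<in>A. \<bar>lagrange A P \<alpha> x\<bar>)"

definition lebesgue_const_deriv ::
    "nat \<Rightarrow> (nat ^ 'm::{finite,linorder}) set \<Rightarrow> ('m::{finite,linorder} \<Rightarrow> nat \<Rightarrow> real) \<Rightarrow> real"
  where "lebesgue_const_deriv k A P =
    (\<Sum>\<beta> | (\<Sum>i\<in>UNIV. \<beta> $ i) \<le> k. SUP x\<in>cube. \<Sum>\<alpha>\<in>A. \<bar>mpartial \<beta> (lagrange A P \<alpha>) x\<bar>)"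

subsection \<open>Asymptotic notation\<close>

definition lesssim :: "(nat \<Rightarrow> real) \<Rightarrow> (nat \<Rightarrow> real) \<Rightarrow> bool"
  where "lesssim a b \<longleftrightarrow> (\<exists>C. \<forall>n. a n \<le> C * b n)"

definition O_eps :: "real \<Rightarrow> (nat \<Rightarrow> real) \<Rightarrow> bool"
  where "O_eps \<rho> g \<longleftrightarrow> (\<forall>\<epsilon>. 0 < \<epsilon> \<and> \<epsilon> < \<rho> \<longrightarrow> g \<in> O(\<lambda>n. (\<rho> - \<epsilon>) powr - real n))"

end

theory Submission
  imports Defs "HOL-Computational_Algebra.Polynomial"
begin

text \<open>Fix a level \<open>n\<close>, let \<open>A\<close> be its index set, \<open>L \<alpha>\<close> the Lagrange basis, \<open>Q\<close> the interpolant of \<open>f\<close>,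
\<open>r n\<close> the best approximation and \<open>\<Lambda> k\<close> the Lebesgue constant of order \<open>k\<close>. Interpolation reproduces
\<open>poly_space A\<close>, so \<open>Q - r n\<close> is the sum of \<open>(f - r n) (grid_node P \<alpha>) * L \<alpha>\<close>, and a derivative of
order at most \<open>k\<close> of \<open>f - Q\<close> is bounded by the same derivative of \<open>f - r n\<close> plus \<open>\<rho> ^ (-n) * \<Lambda> k\<close>
up to a constant (\<open>mpartial_interpolation_error\<close>).

The derivatives of \<open>f - r n\<close> are controlled by telescoping: \<open>r (j + 1) - r j\<close> is a polynomial of
size \<open>\<rho> ^ (-j)\<close>, and each derivative costs a factor of order \<open>j ^ 2\<close> by Markov's inequality. Summing the
resulting geometric tail shows that \<open>f\<close> is smooth on the cube and that derivatives of order \<open>k\<close> of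
\<open>f - r n\<close> are of size \<open>n ^ (2 * k) * \<rho> ^ (-n)\<close> (\<open>approx_rate_mpartial\<close>). The claim has no factor
\<open>n ^ (2 * k)\<close>, but it does not have to: the Chebyshev polynomial of degree \<open>n\<close> in one coordinate
belongs to \<open>poly_space A\<close> and is bounded by 1 at the nodes, while its \<open>k\<close>-th derivative at the corner
is of order \<open>n ^ (2 * k)\<close>. Hence \<open>\<Lambda> k\<close> itself has at least that order and
absorbs the loss (\<open>power_le_lebesgue_const_deriv\<close>). This is why Markov's inequality is needed with the
sharp exponent 2, whereas its constant is irrelevant.

For the second half, \<open>\<Lambda> k\<close> must grow only polynomially. As \<open>A\<close> is downward closed, interpolation on the
grid is the sum over \<open>\<alpha>\<close> in \<open>A\<close> of tensor products of increments, the difference of the univariate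
interpolation operators on the first \<open>\<alpha> i + 1\<close> and on the first \<open>\<alpha> i\<close> nodes. This
formula yields existence and uniqueness of the interpolant, and also the polynomial bound on \<open>\<Lambda> 0\<close>,
because each increment is bounded by twice a univariate Lebesgue constant and \<open>A\<close> has at most
\<open>(n + 1) ^ m\<close> elements (\<open>sum_abs_lagrange_le\<close>). Markov's inequality applied to signed sums of the
\<open>L \<alpha>\<close> passes from \<open>\<Lambda> 0\<close> to \<open>\<Lambda> k\<close>. The statement without derivatives is the case \<open>k = 0\<close>.\<close>

section \<open>Univariate Lagrange interpolation\<close>

text \<open>The fundamental polynomials as elements of the polynomial type, which gives access to degrees,
root counting and formal derivatives.\<close>
definition lagrange1_poly :: "(nat \<Rightarrow> real) \<Rightarrow> nat \<Rightarrow> nat \<Rightarrow> real poly"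
  where "lagrange1_poly q h j = (\<Prod>i\<in>{..h} - {j}. [:- q i / (q j - q i), 1 / (q j - q i):])"

lemma poly_lagrange1_poly: "poly (lagrange1_poly q h j) x = lagrange1 q h j x"
  by (simp add: lagrange1_poly_def lagrange1_def poly_prod diff_divide_distrib)

lemma degree_lagrange1_poly: "j \<le> h \<Longrightarrow> degree (lagrange1_poly q h j) \<le> h"
proof -
  assume j: "j \<le> h"
  have "degree (lagrange1_poly q h j)
      \<le> sum (degree \<circ> (\<lambda>i. [:- q i / (q j - q i), 1 / (q j - q i):])) ({..h} - {j})"
    unfolding lagrange1_poly_def by (rule degree_prod_sum_le) simp
  also have "\<dots> \<le> (\<Sum>i\<in>{..h} - {j}. 1)"
    by (intro sum_mono) simp
  finally show ?thesis using j by simp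
qed

lemma lagrange1_at_node:
  assumes "inj_on q {..h}" "j \<le> h" "c \<le> h"
  shows "lagrange1 q h j (q c) = (if j = c then 1 else 0)"
proof (cases "j = c")
  case True
  have "(q c - q i) / (q c - q i) = 1" if "i \<in> {..h} - {c}" for i
  proof -
    have "q c \<noteq> q i" using that assms(1,3) by (auto simp: inj_on_def)
    then show ?thesis by simp
  qed
  then show ?thesis using True by (simp add: lagrange1_def)
next
  case False
  then show ?thesis using assms by (auto simp: lagrange1_def intro!: prod_zero)
qed

text \<open>Both sides are polynomials of degree at most \<open>h\<close> that agree at \<open>h + 1\<close> nodes.\<close>
lemma lagrange1_reproduces:
  assumes "inj_on q {..h}" "degree u \<le> h"
  shows "(\<Sum>j\<le>h. poly u (q j) * lagrange1 q h j x) = poly u x"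
proof -
  let ?v = "\<Sum>j\<le>h. smult (poly u (q j)) (lagrange1_poly q h j)"
  have "?v = u"
  proof (rule poly_eqI_degree)
    have card: "card (q ` {..h}) = Suc h"
      using assms(1) by (simp add: card_image)
    have "degree ?v \<le> h"
      by (rule degree_sum_le) (auto intro: order.trans[OF degree_smult_le] degree_lagrange1_poly)
    then show "degree ?v < card (q ` {..h})" by (simp add: card)
    show "degree u < card (q ` {..h})" using assms(2) by (simp add: card)
    fix y assume "y \<in> q ` {..h}"
    then obtain c where c: "c \<le> h" "y = q c" by auto
    have "poly ?v y = (\<Sum>j\<le>h. if j = c then poly u (q c) else 0)"
      unfolding poly_sum using assms(1) c
      by (intro sum.cong refl) (simp add: poly_lagrange1_poly lagrange1_at_node)
    then show "poly ?v y = poly u y" using c by simp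
  qed
  then have "poly ?v x = poly u x" by simp
  then show ?thesis by (simp add: poly_sum poly_lagrange1_poly)
qed

lemma sum_abs_lagrange1_le:
  assumes "t \<in> {-1..1}"
  shows "(\<Sum>j\<le>h. \<bar>lagrange1 q h j t\<bar>) \<le> lebesgue_const1 q h"
proof -
  have "continuous_on {-1..1} (\<lambda>x. \<Sum>j\<le>h. \<bar>poly (lagrange1_poly q h j) x\<bar>)"
    by (intro continuous_intros)
  then have "bdd_above ((\<lambda>x. \<Sum>j\<le>h. \<bar>lagrange1 q h j x\<bar>) ` {-1..1})"
    unfolding poly_lagrange1_poly
    by (intro bounded_imp_bdd_above compact_imp_bounded compact_continuous_image) auto
  then show ?thesis
    unfolding lebesgue_const1_def using assms by (rule cSUP_upper2) simp_all
qed

section \<open>Chebyshev polynomials and Markov's inequality\<close>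

fun chebyshev :: "nat \<Rightarrow> real poly"
  where
    "chebyshev 0 = 1"
  | "chebyshev (Suc 0) = [:0, 1:]"
  | "chebyshev (Suc (Suc n)) = [:0, 2:] * chebyshev (Suc n) - chebyshev n"

lemma degree_chebyshev: "degree (chebyshev n) \<le> n"
proof (induction n rule: chebyshev.induct)
  case (3 n)
  have "degree ([:0, 2:] * chebyshev (Suc n)) \<le> 1 + Suc n"
    using 3(1) by (intro order.trans[OF degree_mult_le] add_mono) simp_all
  then show ?case using 3(2) by (auto intro: degree_diff_le)
qed simp_all

lemma chebyshev_cos: "poly (chebyshev n) (cos t) = cos (real n * t)"
proof (induction n rule: chebyshev.induct)
  case (3 n)
  have "cos (real (Suc (Suc n)) * t) + cos (real n * t) = 2 * cos t * cos (real (Suc n) * t)"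
  proof -
    have "real (Suc (Suc n)) * t = real (Suc n) * t + t" "real n * t = real (Suc n) * t - t"
      by (simp_all add: algebra_simps)
    then show ?thesis by (simp only: cos_add cos_diff) (simp add: algebra_simps)
  qed
  then show ?case using 3 by simp
qed simp_all

lemma abs_chebyshev_le_1: "x \<in> {-1..1} \<Longrightarrow> \<bar>poly (chebyshev n) x\<bar> \<le> 1"
  using chebyshev_cos[of n "arccos x"] by (simp add: cos_arccos_abs)

lemma chebyshev_at_1: "poly (chebyshev n) 1 = 1"
  using chebyshev_cos[of n 0] by simp

text \<open>Differentiate \<open>T (cos t) = cos (n t)\<close> twice: the identity holds at every \<open>cos t\<close>, that is, at infinitely
many points, hence formally. The point of the equation is that it degenerates at 1 and there turns into a
recursion for the values of the higher derivatives.\<close>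
lemma chebyshev_ode:
  "[:1, 0, -1:] * (pderiv ^^ 2) (chebyshev n) - [:0, 1:] * pderiv (chebyshev n)
     + smult (real n ^ 2) (chebyshev n) = 0" (is "?u = 0")
proof (rule ccontr)
  assume nz: "?u \<noteq> 0"
  have "poly ?u (cos t) = 0" if "0 < t" "t < pi" for t
  proof -
    let ?T = "chebyshev n"
    have eq: "(\<lambda>t. poly ?T (cos t)) = (\<lambda>t. cos (real n * t))"
      by (simp add: chebyshev_cos)
    have d1: "((\<lambda>t. poly ?T (cos t)) has_real_derivative poly (pderiv ?T) (cos t) * (- sin t)) (at t)" for t
      by (rule DERIV_chain2[OF poly_DERIV DERIV_cos])
    have d1': "((\<lambda>t. poly ?T (cos t)) has_real_derivative - real n * sin (real n * t)) (at t)" for t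
      unfolding eq by (auto intro!: derivative_eq_intros)
    have e1: "poly (pderiv ?T) (cos t) * (- sin t) = - real n * sin (real n * t)" for t
      using DERIV_unique[OF d1 d1'] .
    have d2: "((\<lambda>t. poly (pderiv ?T) (cos t) * (- sin t)) has_real_derivative
        poly (pderiv (pderiv ?T)) (cos t) * (- sin t) * (- sin t) + poly (pderiv ?T) (cos t) * (- cos t)) (at t)"
      by (rule derivative_eq_intros refl DERIV_chain2[OF poly_DERIV DERIV_cos])+ simp
    have d2': "((\<lambda>t. poly (pderiv ?T) (cos t) * (- sin t)) has_real_derivative - (real n ^ 2) * cos (real n * t)) (at t)"
      unfolding e1 by (auto intro!: derivative_eq_intros simp: power2_eq_square)
    have "poly (pderiv (pderiv ?T)) (cos t) * (sin t)\<^sup>2 - poly (pderiv ?T) (cos t) * cos t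
        = - (real n ^ 2) * poly ?T (cos t)"
      using DERIV_unique[OF d2 d2'] by (simp add: chebyshev_cos power2_eq_square)
    then show ?thesis
      unfolding sin_squared_eq by (simp add: numeral_2_eq_2 algebra_simps)
  qed
  then have "cos ` {0<..<pi} \<subseteq> {x. poly ?u x = 0}" by auto
  moreover have "infinite (cos ` {0<..<pi})"
  proof -
    have "inj_on cos {0<..<pi}"
      by (auto intro!: inj_onI cos_inj_pi)
    then show ?thesis using pi_gt_zero by (simp add: finite_image_iff infinite_Ioo)
  qed
  ultimately show False
    using poly_roots_finite[OF nz] finite_subset by blast
qed

lemma chebyshev_ode_higher:
  "[:1, 0, -1:] * (pderiv ^^ (k + 2)) (chebyshev n) - smult (2 * real k + 1) ([:0, 1:] * (pderiv ^^ (k + 1)) (chebyshev n))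
     + smult (real n ^ 2 - real k ^ 2) ((pderiv ^^ k) (chebyshev n)) = 0"
proof (induction k)
  case 0
  then show ?case using chebyshev_ode[of n] by (simp add: numeral_2_eq_2)
next
  case (Suc k)
  define a where "a = (pderiv ^^ k) (chebyshev n)"
  have "pderiv ([:1, 0, -1:] * pderiv (pderiv a) - smult (2 * real k + 1) ([:0, 1:] * pderiv a)
     + smult (real n ^ 2 - real k ^ 2) a) = 0"
    using Suc by (simp add: a_def numeral_2_eq_2)
  moreover have "pderiv ([:1, 0, -1:] * pderiv (pderiv a) - smult (2 * real k + 1) ([:0, 1:] * pderiv a)
     + smult (real n ^ 2 - real k ^ 2) a)
    = [:1, 0, -1:] * pderiv (pderiv (pderiv a)) - smult (2 * real (Suc k) + 1) ([:0, 1:] * pderiv (pderiv a))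
     + smult (real n ^ 2 - real (Suc k) ^ 2) (pderiv a)"
    by (rule poly_eq_poly_eq_iff[THEN iffD1], rule ext)
      (simp add: pderiv_add pderiv_diff pderiv_mult pderiv_smult pderiv_pCons pderiv_minus power2_eq_square algebra_simps)
  ultimately show ?case by (simp add: a_def numeral_2_eq_2)
qed

lemma chebyshev_higher_deriv_at_1_Suc:
  "(2 * real k + 1) * poly ((pderiv ^^ Suc k) (chebyshev n)) 1
     = (real n ^ 2 - real k ^ 2) * poly ((pderiv ^^ k) (chebyshev n)) 1"
proof -
  have "poly ([:1, 0, -1:] * (pderiv ^^ (k + 2)) (chebyshev n) - smult (2 * real k + 1) ([:0, 1:] * (pderiv ^^ (k + 1)) (chebyshev n))
     + smult (real n ^ 2 - real k ^ 2) ((pderiv ^^ k) (chebyshev n))) 1 = 0"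
    by (simp only: chebyshev_ode_higher poly_0)
  then show ?thesis by simp
qed

lemma chebyshev_deriv_at_1: "poly (pderiv (chebyshev n)) 1 = real n ^ 2"
  using chebyshev_higher_deriv_at_1_Suc[of 0 n] by (simp add: chebyshev_at_1)

text \<open>The recursion makes the \<open>i\<close>-th derivative at 1 a product of the quotients
\<open>(n^2 - l^2) / (2 l + 1)\<close> over \<open>l < i\<close>. Each quotient is comparable to \<open>n^2\<close> as long as \<open>l\<close> stays
below a fixed \<open>k \<le> n\<close>; the explicit constant serves only to make that uniform in \<open>n\<close>.\<close>
lemma chebyshev_higher_deriv_at_1_ge:
  assumes "i \<le> k" "1 \<le> k" "k \<le> n"
  shows "((real n + 1)\<^sup>2 / (8 * real k ^ 2)) ^ i \<le> poly ((pderiv ^^ i) (chebyshev n)) 1"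
  using assms(1)
proof (induction i)
  case 0
  then show ?case by (simp add: chebyshev_at_1)
next
  case (Suc i)
  let ?D = "\<lambda>i. poly ((pderiv ^^ i) (chebyshev n)) 1"
  have ik: "real i + 1 \<le> real k" "real k \<le> real n" "1 \<le> real k" using Suc.prems assms by linarith+
  have "(real k - 1) * (real n - real k) \<ge> 0" using ik by simp
  then have "real n \<le> real k * (real n - real k + 1)" by (simp add: algebra_simps)
  also have "\<dots> \<le> real k * (real n - real i)" using ik by (intro mult_left_mono) auto
  finally have "real n * real n \<le> real k * (real n - real i) * (real n + real i)"
    using ik by (intro mult_mono) auto
  then have 1: "real n ^ 2 \<le> real k * (real n ^ 2 - real i ^ 2)" by (simp add: power2_eq_square algebra_simps)
  have "(real n + 1)\<^sup>2 \<le> (2 * real n)\<^sup>2" using ik by (intro power_mono) auto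
  then have "(real n + 1)\<^sup>2 * (2 * real i + 1) \<le> (4 * real k * (real n ^ 2 - real i ^ 2)) * (2 * real k)"
    using 1 ik by (intro mult_mono) auto
  then have "(real n + 1)\<^sup>2 / (8 * real k ^ 2) \<le> (real n ^ 2 - real i ^ 2) / (2 * real i + 1)"
    using ik by (simp add: field_simps power2_eq_square)
  moreover have "0 \<le> (real n ^ 2 - real i ^ 2) / (2 * real i + 1)"
    using ik by (simp add: power_mono)
  ultimately have "((real n + 1)\<^sup>2 / (8 * real k ^ 2)) * ((real n + 1)\<^sup>2 / (8 * real k ^ 2)) ^ i
     \<le> (real n ^ 2 - real i ^ 2) / (2 * real i + 1) * ?D i"
    using Suc by (intro mult_mono) auto
  also have "\<dots> = ?D (Suc i)"
    using chebyshev_higher_deriv_at_1_Suc[of i n] by (simp add: field_simps)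
  finally show ?case by simp
qed

text \<open>With the nodes listed from right to left, beyond the first node the \<open>j\<close>-th fundamental polynomial has
constant sign \<open>(-1) ^ j\<close>, since exactly the \<open>j\<close> nodes to the right of node \<open>j\<close> contribute a negative
factor to the denominator. Consequently data of alternating sign maximise the growth of the interpolating
polynomial to the right of all nodes.\<close>
lemma abs_lagrange1_growth_right_of_first_node:
  assumes desc: "\<And>i j. i < j \<Longrightarrow> j \<le> h \<Longrightarrow> q j < q i" and "j \<le> h" "q 0 \<le> x"
  shows "\<bar>lagrange1 q h j x - lagrange1 q h j (q 0)\<bar> = (-1) ^ j * (lagrange1 q h j x - lagrange1 q h j (q 0))"
proof -
  have inj: "inj_on q {..h}"
  proof (rule inj_onI, rule ccontr)
    fix a b assume "a \<in> {..h}" "b \<in> {..h}" "q a = q b" "a \<noteq> b"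
    then show False using desc[of a b] desc[of b a] by (auto simp: neq_iff)
  qed
  have le0: "q i \<le> q 0" if "i \<le> h" for i using desc[of 0 i] that by (cases "i = 0") auto
  show ?thesis
  proof (cases "j = 0")
    case True
    have "1 \<le> lagrange1 q h 0 x"
      unfolding lagrange1_def
    proof (rule prod_ge_1)
      fix i assume "i \<in> {..h} - {0}"
      then have "q i < q 0" using desc[of 0 i] by auto
      then show "1 \<le> (x - q i) / (q 0 - q i)" using assms(3) by simp
    qed
    then show ?thesis using True by (simp add: lagrange1_at_node[OF inj])
  next
    case False
    then have z: "lagrange1 q h j (q 0) = 0" using assms(2) by (simp add: lagrange1_at_node[OF inj])
    have split: "{..h} - {j} = {..<j} \<union> {j<..h}" using assms(2) by auto
    have "lagrange1 q h j x
        = (\<Prod>i\<in>{..<j}. (x - q i) / (q j - q i)) * (\<Prod>i\<in>{j<..h}. (x - q i) / (q j - q i))"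
      unfolding lagrange1_def split by (rule prod.union_disjoint) auto
    also have "(\<Prod>i\<in>{..<j}. (x - q i) / (q j - q i)) = (\<Prod>i\<in>{..<j}. (-1) * ((x - q i) / (q i - q j)))"
    proof (rule prod.cong)
      fix i assume "i \<in> {..<j}"
      then have "q j \<noteq> q i" using desc[of i j] assms(2) by auto
      then show "(x - q i) / (q j - q i) = (-1) * ((x - q i) / (q i - q j))" by (simp add: field_simps)
    qed simp
    also have "\<dots> = (-1) ^ j * (\<Prod>i\<in>{..<j}. (x - q i) / (q i - q j))"
      by (subst prod.distrib) simp
    finally have "lagrange1 q h j x = (-1) ^ j *
       ((\<Prod>i\<in>{..<j}. (x - q i) / (q i - q j)) * (\<Prod>i\<in>{j<..h}. (x - q i) / (q j - q i)))" (is "_ = _ * ?r")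
      by simp
    moreover have "0 \<le> ?r"
    proof (intro mult_nonneg_nonneg prod_nonneg divide_nonneg_nonneg)
      fix i assume "i \<in> {..<j}"
      then have "q j < q i" "i \<le> h" using desc[of i j] assms(2) by auto
      then show "0 \<le> x - q i" "0 \<le> q i - q j" using le0[of i] assms(3) by auto
    next
      fix i assume "i \<in> {j<..h}"
      then have "q i < q j" "i \<le> h" using desc[of j i] by auto
      then show "0 \<le> x - q i" "0 \<le> q j - q i" using le0[of i] assms(3) by auto
    qed
    ultimately show ?thesis
      using z by (cases "even j") (simp_all del: prod_constant)
  qed
qed

text \<open>Among all polynomials of degree at most \<open>n\<close> bounded by \<open>M\<close> the multiple \<open>M * T\<close> of the Chebyshev polynomial grows fastest to the
right of 1: it takes alternating values \<open>M, -M, M, ...\<close> at the extremal nodes \<open>cos (j \<pi> / n)\<close>. Comparing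
difference quotients at 1 gives the comparison of the derivatives.\<close>
lemma markov_endpoint:
  assumes "degree u \<le> n" "\<And>x. x \<in> {-1..1} \<Longrightarrow> \<bar>poly u x\<bar> \<le> M"
  shows "\<bar>poly (pderiv u) 1\<bar> \<le> real n ^ 2 * M"
proof (cases "n = 0")
  case True
  then have "pderiv u = 0" using assms(1) by (simp add: pderiv_eq_0_iff)
  then show ?thesis using True by simp
next
  case False
  \<comment> \<open>The extremal points of the Chebyshev polynomial, from right to left.\<close>
  define q where "q = (\<lambda>j. cos (real j * pi / real n))"
  let ?T = "chebyshev n"
  have desc: "q j < q i" if "i < j" "j \<le> n" for i j
    unfolding q_def
  proof (rule cos_monotone_0_pi)
    show "0 \<le> real i * pi / real n" by simp
    show "real i * pi / real n < real j * pi / real n" using that False by (simp add: divide_strict_right_mono)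
    show "real j * pi / real n \<le> pi" using that False by (simp add: field_simps)
  qed
  have inj: "inj_on q {..n}"
  proof (rule inj_onI, rule ccontr)
    fix a b assume "a \<in> {..n}" "b \<in> {..n}" "q a = q b" "a \<noteq> b"
    then show False using desc[of a b] desc[of b a] by (auto simp: neq_iff)
  qed
  have Tq: "poly ?T (q j) = (-1) ^ j" for j
    unfolding q_def chebyshev_cos using False by (simp add: cos_npi)
  have q0: "q 0 = 1" by (simp add: q_def)
  have qc: "q j \<in> {-1..1}" for j by (simp add: q_def)
  have growth: "\<bar>poly u x - poly u 1\<bar> \<le> M * (poly ?T x - poly ?T 1)" if "1 \<le> x" for x
  proof -
    let ?d = "\<lambda>j. lagrange1 q n j x - lagrange1 q n j (q 0)"
    have diff: "poly v x - poly v 1 = (\<Sum>j\<le>n. poly v (q j) * ?d j)" if "degree v \<le> n" for v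
      using lagrange1_reproduces[OF inj that, of x] lagrange1_reproduces[OF inj that, of 1]
      by (simp add: q0 algebra_simps sum_subtractf)
    have "\<bar>poly u x - poly u 1\<bar> \<le> (\<Sum>j\<le>n. \<bar>poly u (q j) * ?d j\<bar>)"
      unfolding diff[OF assms(1)] by (rule sum_abs)
    also have "\<dots> \<le> (\<Sum>j\<le>n. M * ((-1) ^ j * ?d j))"
    proof (rule sum_mono)
      fix j assume "j \<in> {..n}"
      then have "\<bar>?d j\<bar> = (-1) ^ j * ?d j"
        using desc that q0 by (intro abs_lagrange1_growth_right_of_first_node) auto
      then show "\<bar>poly u (q j) * ?d j\<bar> \<le> M * ((-1) ^ j * ?d j)"
        using assms(2)[OF qc[of j]] unfolding abs_mult by (metis abs_ge_zero mult_right_mono)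
    qed
    also have "\<dots> = M * (poly ?T x - poly ?T 1)"
      unfolding diff[OF degree_chebyshev] Tq by (simp add: sum_distrib_left)
    finally show ?thesis .
  qed
  have lim: "((\<lambda>x. (poly v x - poly v 1) / (x - 1)) \<longlongrightarrow> poly (pderiv v) 1) (at_right 1)" for v :: "real poly"
    using poly_DERIV[of v 1] unfolding has_field_derivative_iff by (rule tendsto_within_subset) simp
  have "((\<lambda>x. \<bar>(poly u x - poly u 1) / (x - 1)\<bar>) \<longlongrightarrow> \<bar>poly (pderiv u) 1\<bar>) (at_right 1)"
    by (intro tendsto_rabs lim)
  moreover have "((\<lambda>x. M * ((poly ?T x - poly ?T 1) / (x - 1))) \<longlongrightarrow> M * poly (pderiv ?T) 1) (at_right 1)"
    by (intro tendsto_mult_left lim)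
  moreover have "\<forall>\<^sub>F x in at_right 1. \<bar>(poly u x - poly u 1) / (x - 1)\<bar> \<le> M * ((poly ?T x - poly ?T 1) / (x - 1))"
  proof (rule eventually_at_right_less[THEN eventually_mono])
    fix x :: real assume "1 < x"
    then show "\<bar>(poly u x - poly u 1) / (x - 1)\<bar> \<le> M * ((poly ?T x - poly ?T 1) / (x - 1))"
      using growth[of x] by (simp add: abs_divide divide_right_mono)
  qed
  ultimately have "\<bar>poly (pderiv u) 1\<bar> \<le> M * poly (pderiv ?T) 1"
    by (intro tendsto_le[OF trivial_limit_at_right_real]) auto
  then show ?thesis by (simp add: chebyshev_deriv_at_1 mult.commute)
qed

text \<open>For \<open>t \<ge> 0\<close> the interval from \<open>-1\<close> to \<open>t\<close> has at least half the length of the whole one, so the estimate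
at the right endpoint, transported to this interval, loses at most a factor 2.\<close>
lemma markov_right_half:
  assumes "degree u \<le> n" "\<And>x. x \<in> {-1..1} \<Longrightarrow> \<bar>poly u x\<bar> \<le> M" "0 \<le> t" "t \<le> 1"
  shows "\<bar>poly (pderiv u) t\<bar> \<le> 2 * real n ^ 2 * M"
proof -
  \<comment> \<open>The affine map from the unit interval onto the segment from -1 to t, which sends 1 to t.\<close>
  let ?a = "[:(t - 1) / 2, (t + 1) / 2:]"
  have a: "poly ?a x \<in> {-1..1}" if "x \<in> {-1..1}" for x
  proof -
    have "0 \<le> (t + 1) * (x + 1)"
      using that assms(3) by (intro mult_nonneg_nonneg) auto
    moreover have "(t + 1) * (x + 1) \<le> 2 * 2"
      using that assms(3,4) by (intro mult_mono) auto
    moreover have "poly ?a x = (t + 1) * (x + 1) / 2 - 1"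
      by (simp add: field_simps)
    ultimately show ?thesis by simp
  qed
  have "degree (pcompose u ?a) \<le> n"
    using degree_pcompose_le[of u ?a] assms(1) by (simp split: if_splits)
  then have "\<bar>poly (pderiv (pcompose u ?a)) 1\<bar> \<le> real n ^ 2 * M"
  proof (rule markov_endpoint)
    fix x :: real assume "x \<in> {-1..1}"
    from assms(2)[OF a[OF this]] show "\<bar>poly (pcompose u ?a) x\<bar> \<le> M"
      by (simp only: poly_pcompose)
  qed
  moreover have "poly (pderiv (pcompose u ?a)) 1 = poly (pderiv u) t * ((t + 1) / 2)"
    by (simp add: pderiv_pcompose poly_pcompose pderiv_pCons field_simps)
  ultimately have "\<bar>poly (pderiv u) t\<bar> * ((t + 1) / 2) \<le> real n ^ 2 * M"
    using assms(3) by (simp add: abs_mult)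
  moreover have "\<bar>poly (pderiv u) t\<bar> * (1 / 2) \<le> \<bar>poly (pderiv u) t\<bar> * ((t + 1) / 2)"
    using assms(3) by (intro mult_left_mono) auto
  ultimately show ?thesis by simp
qed

text \<open>The factor 2 is not optimal; what matters below is the exponent of the degree.\<close>
lemma markov_inequality:
  assumes "degree u \<le> n" "\<And>x. x \<in> {-1..1} \<Longrightarrow> \<bar>poly u x\<bar> \<le> M" "t \<in> {-1..1}"
  shows "\<bar>poly (pderiv u) t\<bar> \<le> 2 * real n ^ 2 * M"
proof (cases "0 \<le> t")
  case True
  then show ?thesis using assms by (intro markov_right_half) auto
next
  case False
  let ?v = "pcompose u [:0, -1:]"
  have "\<bar>poly (pderiv ?v) (- t)\<bar> \<le> 2 * real n ^ 2 * M"
  proof (rule markov_right_half)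
    show "degree ?v \<le> n" using degree_pcompose_le[of u "[:0, -1:]"] assms(1) by simp
    fix x :: real assume "x \<in> {-1..1}"
    then show "\<bar>poly ?v x\<bar> \<le> M"
      using assms(2)[of "- x"] by (simp add: poly_pcompose)
  qed (use False assms(3) in auto)
  then show ?thesis by (simp add: pderiv_pcompose poly_pcompose pderiv_pCons)
qed

section \<open>Polynomial spaces over downward closed index sets\<close>

text \<open>Such sets are also called lower sets of multi-indices.\<close>
definition downward_closed :: "(nat ^ 'm) set \<Rightarrow> bool"
  where "downward_closed A \<longleftrightarrow> (\<forall>\<alpha>\<in>A. \<forall>\<beta>. (\<forall>i. \<beta> $ i \<le> \<alpha> $ i) \<longrightarrow> \<beta> \<in> A)"

lemma downward_closedD:
  "downward_closed A \<Longrightarrow> \<alpha> \<in> A \<Longrightarrow> (\<And>i. \<beta> $ i \<le> \<alpha> $ i) \<Longrightarrow> \<beta> \<in> A"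
  by (auto simp: downward_closed_def)

lemma bij_betw_vec_lambda_PiE:
  "bij_betw (vec_lambda :: ('m \<Rightarrow> 'a) \<Rightarrow> 'a ^ 'm) (PiE UNIV S) {\<gamma>. \<forall>i. \<gamma> $ i \<in> S i}"
  by (rule bij_betwI[where g = vec_nth]) auto

lemma finite_vec_box:
  fixes S :: "'m::finite \<Rightarrow> 'a set"
  assumes "\<And>i. finite (S i)"
  shows "finite {\<gamma> :: 'a ^ 'm. \<forall>i. \<gamma> $ i \<in> S i}"
  using bij_betw_finite[OF bij_betw_vec_lambda_PiE[of S]] assms by (simp add: finite_PiE)

lemma card_vec_box:
  fixes S :: "'m::finite \<Rightarrow> 'a set"
  shows "card {\<gamma> :: 'a ^ 'm. \<forall>i. \<gamma> $ i \<in> S i} = (\<Prod>i\<in>UNIV. card (S i))"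
  using bij_betw_same_card[OF bij_betw_vec_lambda_PiE[of S]] by (simp add: card_PiE)

text \<open>Distributivity, indexed by vectors rather than by extensional functions; it is what turns tensor
products of univariate sums into sums over multi-indices.\<close>
lemma prod_sum_vec:
  fixes g :: "'m::finite \<Rightarrow> 'a \<Rightarrow> 'b::comm_semiring_1"
  assumes "\<And>i. finite (S i)"
  shows "(\<Prod>i\<in>UNIV. \<Sum>h\<in>S i. g i h) = (\<Sum>\<gamma> | \<forall>i. \<gamma> $ i \<in> S i. \<Prod>i\<in>UNIV. g i (\<gamma> $ i))"
proof -
  have "(\<Prod>i\<in>UNIV. \<Sum>h\<in>S i. g i h) = (\<Sum>\<phi>\<in>PiE UNIV S. \<Prod>i\<in>UNIV. g i (\<phi> i))"
    using assms by (intro prod_sum_PiE) auto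
  also have "\<dots> = (\<Sum>\<gamma> | \<forall>i. \<gamma> $ i \<in> S i. \<Prod>i\<in>UNIV. g i (\<gamma> $ i))"
    by (subst sum.reindex_bij_betw[OF bij_betw_vec_lambda_PiE, symmetric]) simp
  finally show ?thesis .
qed

lemma poly_spaceI:
  "q = (\<lambda>x. \<Sum>\<alpha>\<in>A. c \<alpha> * (\<Prod>i\<in>UNIV. (x $ i) ^ (\<alpha> $ i))) \<Longrightarrow> q \<in> poly_space A"
  by (auto simp: poly_space_def)

lemma poly_space_sum:
  assumes "\<And>j. j \<in> J \<Longrightarrow> g j \<in> poly_space A"
  shows "(\<lambda>x. \<Sum>j\<in>J. c j * g j x) \<in> poly_space A"
proof -
  have "\<forall>j\<in>J. \<exists>d. g j = (\<lambda>x. \<Sum>\<alpha>\<in>A. d \<alpha> * (\<Prod>i\<in>UNIV. (x $ i) ^ (\<alpha> $ i)))"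
    using assms by (auto simp: poly_space_def)
  from bchoice[OF this] obtain d where d: "\<And>j. j \<in> J \<Longrightarrow> g j = (\<lambda>x. \<Sum>\<alpha>\<in>A. d j \<alpha> * (\<Prod>i\<in>UNIV. (x $ i) ^ (\<alpha> $ i)))"
    by blast
  show ?thesis
  proof (rule poly_spaceI[where c = "\<lambda>\<alpha>. \<Sum>j\<in>J. c j * d j \<alpha>"], rule ext)
    fix x
    have "(\<Sum>j\<in>J. c j * g j x) = (\<Sum>j\<in>J. \<Sum>\<alpha>\<in>A. c j * d j \<alpha> * (\<Prod>i\<in>UNIV. (x $ i) ^ (\<alpha> $ i)))"
      using d by (intro sum.cong refl) (simp add: sum_distrib_left mult.assoc)
    also have "\<dots> = (\<Sum>\<alpha>\<in>A. (\<Sum>j\<in>J. c j * d j \<alpha>) * (\<Prod>i\<in>UNIV. (x $ i) ^ (\<alpha> $ i)))"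
      by (subst sum.swap) (simp add: sum_distrib_right)
    finally show "(\<Sum>j\<in>J. c j * g j x) = (\<Sum>\<alpha>\<in>A. (\<Sum>j\<in>J. c j * d j \<alpha>) * (\<Prod>i\<in>UNIV. (x $ i) ^ (\<alpha> $ i)))" .
  qed
qed

lemma poly_space_mono:
  fixes A B :: "(nat ^ 'm::finite) set"
  assumes "A \<subseteq> B" "finite B"
  shows "poly_space A \<subseteq> poly_space B"
proof
  fix q :: "'a ^ 'm \<Rightarrow> 'a" assume "q \<in> poly_space A"
  then obtain c where c: "q = (\<lambda>x. \<Sum>\<alpha>\<in>A. c \<alpha> * (\<Prod>i\<in>UNIV. (x $ i) ^ (\<alpha> $ i)))"
    by (auto simp: poly_space_def)
  show "q \<in> poly_space B"
    unfolding c
    by (rule poly_spaceI[where c = "\<lambda>\<alpha>. if \<alpha> \<in> A then c \<alpha> else 0"], rule ext, rule sum.mono_neutral_cong_left)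
      (use assms in auto)
qed

lemma monomial_in_poly_space:
  assumes "\<gamma> \<in> A" "finite A"
  shows "(\<lambda>x. c * (\<Prod>i\<in>UNIV. (x $ i) ^ (\<gamma> $ i))) \<in> poly_space A"
proof (rule poly_spaceI[where c = "\<lambda>\<alpha>. if \<alpha> = \<gamma> then c else 0"], rule ext)
  fix x :: "'b ^ 'a"
  have "(\<Sum>\<alpha>\<in>A. (if \<alpha> = \<gamma> then c else 0) * (\<Prod>i\<in>UNIV. (x $ i) ^ (\<alpha> $ i)))
      = (\<Sum>\<alpha>\<in>A. if \<alpha> = \<gamma> then c * (\<Prod>i\<in>UNIV. (x $ i) ^ (\<gamma> $ i)) else 0)"
    by (intro sum.cong) auto
  then show "c * (\<Prod>i\<in>UNIV. (x $ i) ^ (\<gamma> $ i))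
      = (\<Sum>\<alpha>\<in>A. (if \<alpha> = \<gamma> then c else 0) * (\<Prod>i\<in>UNIV. (x $ i) ^ (\<alpha> $ i)))"
    using assms by simp
qed

text \<open>Expanding the product yields only monomials below \<open>\<alpha>\<close>, and those belong to a downward closed \<open>A\<close>.\<close>
lemma tensor_poly_in_poly_space:
  fixes u :: "'m::finite \<Rightarrow> real poly"
  assumes "downward_closed A" "finite A" "\<alpha> \<in> A" "\<And>i. degree (u i) \<le> \<alpha> $ i"
  shows "(\<lambda>x. \<Prod>i\<in>UNIV. poly (u i) (x $ i)) \<in> poly_space A"
proof -
  have "(\<Prod>i\<in>UNIV. poly (u i) (x $ i))
      = (\<Sum>\<gamma> | \<forall>i. \<gamma> $ i \<in> {..\<alpha> $ i}. (\<Prod>i\<in>UNIV. coeff (u i) (\<gamma> $ i)) * (\<Prod>i\<in>UNIV. (x $ i) ^ (\<gamma> $ i)))"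
    for x :: "real ^ 'm"
  proof -
    have "(\<Prod>i\<in>UNIV. poly (u i) (x $ i)) = (\<Prod>i\<in>UNIV. \<Sum>h\<in>{..\<alpha> $ i}. coeff (u i) h * (x $ i) ^ h)"
    proof (rule prod.cong[OF refl])
      fix i
      show "poly (u i) (x $ i) = (\<Sum>h\<in>{..\<alpha> $ i}. coeff (u i) h * (x $ i) ^ h)"
        unfolding poly_altdef using assms(4)[of i]
        by (intro sum.mono_neutral_left) (auto simp: coeff_eq_0)
    qed
    then show ?thesis by (simp only: prod_sum_vec[OF finite_atMost] prod.distrib)
  qed
  then have "(\<lambda>x :: real ^ 'm. \<Prod>i\<in>UNIV. poly (u i) (x $ i)) = (\<lambda>x. \<Sum>\<gamma> | \<forall>i. \<gamma> $ i \<in> {..\<alpha> $ i}.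
      (\<Prod>i\<in>UNIV. coeff (u i) (\<gamma> $ i)) * (1 * (\<Prod>i\<in>UNIV. (x $ i) ^ (\<gamma> $ i))))"
    by (simp only: mult_1)
  also have "\<dots> \<in> poly_space A"
    using assms(1-3) by (intro poly_space_sum monomial_in_poly_space) (auto intro: downward_closedD)
  finally show ?thesis .
qed

section \<open>Increments of univariate interpolation\<close>

text \<open>The \<open>j\<close>-th fundamental polynomial of interpolation at the first \<open>l\<close> nodes. Counting nodes instead of
degrees makes \<open>l = 0\<close> the zero operator, and the value 0 for \<open>j \<ge> l\<close> says that the data at the remaining
nodes are ignored; with both conventions the increments telescope without boundary cases.\<close>
definition trunc_lagrange1 :: "(nat \<Rightarrow> real) \<Rightarrow> nat \<Rightarrow> nat \<Rightarrow> real poly"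
  where "trunc_lagrange1 q l j = (if j < l then lagrange1_poly q (l - 1) j else 0)"

text \<open>The coefficient of the \<open>j\<close>-th datum in the change of the interpolating polynomial when node
\<open>h\<close> is added to its predecessors.\<close>
definition lagrange1_increment :: "(nat \<Rightarrow> real) \<Rightarrow> nat \<Rightarrow> nat \<Rightarrow> real poly"
  where "lagrange1_increment q h j = trunc_lagrange1 q (Suc h) j - trunc_lagrange1 q h j"

lemma sum_lagrange1_increment: "(\<Sum>h\<le>c. lagrange1_increment q h j) = trunc_lagrange1 q (Suc c) j"
  unfolding lagrange1_increment_def lessThan_Suc_atMost[symmetric]
  by (subst sum_lessThan_telescope) (simp add: trunc_lagrange1_def)

lemma degree_trunc_lagrange1: "degree (trunc_lagrange1 q l j) \<le> l - 1"
  by (auto simp: trunc_lagrange1_def intro: degree_lagrange1_poly)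

lemma degree_lagrange1_increment: "degree (lagrange1_increment q h j) \<le> h"
  unfolding lagrange1_increment_def
  using degree_trunc_lagrange1[of q "Suc h" j] degree_trunc_lagrange1[of q h j]
  by (intro degree_diff_le) auto

lemma lagrange1_increment_eq_0: "h < j \<Longrightarrow> lagrange1_increment q h j = 0"
  by (simp add: lagrange1_increment_def trunc_lagrange1_def)

lemma trunc_lagrange1_at_node:
  assumes "inj_on q {..n}" "l \<le> Suc n" "c < l"
  shows "poly (trunc_lagrange1 q l j) (q c) = (if j = c then 1 else 0)"
proof (cases "j < l")
  case True
  have "inj_on q {..l - 1}" using assms(2) by (intro inj_on_subset[OF assms(1)]) auto
  then show ?thesis using True assms(3)
    by (simp add: trunc_lagrange1_def poly_lagrange1_poly lagrange1_at_node)
next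
  case False
  then show ?thesis using assms(3) by (auto simp: trunc_lagrange1_def)
qed

text \<open>Adding a node does not change the interpolating polynomial at the earlier ones.\<close>
lemma lagrange1_increment_at_earlier_node:
  assumes "inj_on q {..n}" "h \<le> n" "c < h"
  shows "poly (lagrange1_increment q h j) (q c) = 0"
  using assms by (simp add: lagrange1_increment_def trunc_lagrange1_at_node[OF assms(1)])

lemma trunc_lagrange1_reproduces:
  assumes "inj_on q {..n}" "l \<le> Suc n" "degree u < l"
  shows "(\<Sum>j\<le>n. poly u (q j) * poly (trunc_lagrange1 q l j) t) = poly u t"
proof -
  have "inj_on q {..l - 1}" using assms(2) by (intro inj_on_subset[OF assms(1)]) auto
  then have "(\<Sum>j\<le>l - 1. poly u (q j) * lagrange1 q (l - 1) j t) = poly u t"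
    using assms(3) by (intro lagrange1_reproduces) auto
  moreover have "(\<Sum>j\<le>n. poly u (q j) * poly (trunc_lagrange1 q l j) t)
      = (\<Sum>j\<le>l - 1. poly u (q j) * lagrange1 q (l - 1) j t)"
    using assms(2,3)
    by (intro sum.mono_neutral_cong_right) (auto simp: trunc_lagrange1_def poly_lagrange1_poly)
  ultimately show ?thesis by simp
qed

text \<open>Both interpolation operators already reproduce \<open>u\<close>.\<close>
lemma lagrange1_increment_annihilates:
  assumes "inj_on q {..n}" "h \<le> n" "degree u < h"
  shows "(\<Sum>j\<le>n. poly u (q j) * poly (lagrange1_increment q h j) t) = 0"
  using trunc_lagrange1_reproduces[OF assms(1), of "Suc h" u t] trunc_lagrange1_reproduces[OF assms(1), of h u t] assms
  by (simp add: lagrange1_increment_def right_diff_distrib sum_subtractf)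

lemma sum_abs_trunc_lagrange1_le:
  assumes "\<And>h. h \<le> n \<Longrightarrow> lebesgue_const1 q h \<le> B" "l \<le> Suc n" "t \<in> {-1..1}"
  shows "(\<Sum>j\<le>n. \<bar>poly (trunc_lagrange1 q l j) t\<bar>) \<le> B"
proof (cases "l = 0")
  case True
  have "0 \<le> (\<Sum>j\<le>n. \<bar>lagrange1 q n j t\<bar>)" by (simp add: sum_nonneg)
  also have "\<dots> \<le> B" using sum_abs_lagrange1_le[OF assms(3), of q n] assms(1)[of n] by simp
  finally show ?thesis using True by (simp add: trunc_lagrange1_def)
next
  case False
  have "(\<Sum>j\<le>n. \<bar>poly (trunc_lagrange1 q l j) t\<bar>) = (\<Sum>j\<le>l - 1. \<bar>lagrange1 q (l - 1) j t\<bar>)"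
    using assms(2) False
    by (intro sum.mono_neutral_cong_right) (auto simp: trunc_lagrange1_def poly_lagrange1_poly)
  also have "\<dots> \<le> lebesgue_const1 q (l - 1)"
    by (rule sum_abs_lagrange1_le[OF assms(3)])
  also have "\<dots> \<le> B"
    using assms(2) by (intro assms(1)) auto
  finally show ?thesis .
qed

lemma sum_abs_lagrange1_increment_le:
  assumes "\<And>h. h \<le> n \<Longrightarrow> lebesgue_const1 q h \<le> B" "h \<le> n" "t \<in> {-1..1}"
  shows "(\<Sum>j\<le>n. \<bar>poly (lagrange1_increment q h j) t\<bar>) \<le> 2 * B"
proof -
  have "(\<Sum>j\<le>n. \<bar>poly (lagrange1_increment q h j) t\<bar>)
      \<le> (\<Sum>j\<le>n. \<bar>poly (trunc_lagrange1 q (Suc h) j) t\<bar> + \<bar>poly (trunc_lagrange1 q h j) t\<bar>)"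
    unfolding lagrange1_increment_def poly_diff by (intro sum_mono abs_triangle_ineq4)
  also have "\<dots> \<le> B + B"
    unfolding sum.distrib using assms by (intro add_mono sum_abs_trunc_lagrange1_le) auto
  finally show ?thesis by simp
qed

section \<open>Interpolation on a grid over a downward closed index set\<close>

text \<open>The explicit Lagrange basis: the coefficient of the datum at node \<open>\<beta>\<close> in the sum over \<open>\<alpha>\<close> in \<open>A\<close> of the
tensor products of univariate increments (a sparse grid, or Smolyak, formula).\<close>
definition tensor_lagrange :: "(nat ^ 'm::finite) set \<Rightarrow> ('m \<Rightarrow> nat \<Rightarrow> real) \<Rightarrow> nat ^ 'm \<Rightarrow> real ^ 'm \<Rightarrow> real"
  where "tensor_lagrange A P \<beta> x =
    (\<Sum>\<alpha>\<in>A. \<Prod>i\<in>UNIV. poly (lagrange1_increment (P i) (\<alpha> $ i) (\<beta> $ i)) (x $ i))"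

locale interpolation_grid =
  fixes A :: "(nat ^ 'm::finite) set" and P :: "'m \<Rightarrow> nat \<Rightarrow> real" and n :: nat
  assumes down: "downward_closed A"
    and le_n: "\<And>\<alpha> i. \<alpha> \<in> A \<Longrightarrow> \<alpha> $ i \<le> n"
    and inj: "\<And>i. inj_on (P i) {..n}"
begin

lemma finite_index: "finite A"
  by (rule finite_subset[OF _ finite_vec_box[of "\<lambda>_. {..n}"]]) (auto intro: le_n)

lemma card_index_le: "card A \<le> (n + 1) ^ CARD('m)"
proof -
  have "card A \<le> card {\<gamma> :: nat ^ 'm. \<forall>i. \<gamma> $ i \<in> {..n}}"
    by (intro card_mono finite_vec_box) (auto intro: le_n)
  then show ?thesis unfolding card_vec_box by simp
qed

lemma tensor_lagrange_in_poly_space: "tensor_lagrange A P \<beta> \<in> poly_space A"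
proof -
  have "(\<lambda>x. \<Sum>\<alpha>\<in>A. 1 * (\<Prod>i\<in>UNIV. poly (lagrange1_increment (P i) (\<alpha> $ i) (\<beta> $ i)) (x $ i))) \<in> poly_space A"
    by (intro poly_space_sum, rule tensor_poly_in_poly_space[OF down finite_index])
      (auto intro: degree_lagrange1_increment)
  then show ?thesis by (simp add: tensor_lagrange_def[abs_def])
qed

lemma sum_over_index_factorizes:
  fixes g :: "'m \<Rightarrow> nat \<Rightarrow> real"
  assumes "\<gamma> \<in> A" "\<And>\<alpha> i. \<alpha> \<in> A \<Longrightarrow> \<gamma> $ i < \<alpha> $ i \<Longrightarrow> g i (\<alpha> $ i) = 0"
  shows "(\<Sum>\<alpha>\<in>A. \<Prod>i\<in>UNIV. g i (\<alpha> $ i)) = (\<Prod>i\<in>UNIV. \<Sum>h\<le>\<gamma> $ i. g i h)"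
proof -
  have "(\<Sum>\<alpha>\<in>A. \<Prod>i\<in>UNIV. g i (\<alpha> $ i)) = (\<Sum>\<alpha> | \<forall>i. \<alpha> $ i \<in> {..\<gamma> $ i}. \<Prod>i\<in>UNIV. g i (\<alpha> $ i))"
  proof (rule sum.mono_neutral_right[OF finite_index])
    show "{\<alpha>. \<forall>i. \<alpha> $ i \<in> {..\<gamma> $ i}} \<subseteq> A"
      using assms(1) by (auto intro: downward_closedD[OF down])
    show "\<forall>\<alpha>\<in>A - {\<alpha>. \<forall>i. \<alpha> $ i \<in> {..\<gamma> $ i}}. (\<Prod>i\<in>UNIV. g i (\<alpha> $ i)) = 0"
    proof
      fix \<alpha> assume "\<alpha> \<in> A - {\<alpha>. \<forall>i. \<alpha> $ i \<in> {..\<gamma> $ i}}"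
      then obtain i where "\<alpha> \<in> A" "\<gamma> $ i < \<alpha> $ i" by (auto simp: not_le)
      then have "g i (\<alpha> $ i) = 0" by (rule assms(2))
      then show "(\<Prod>i\<in>UNIV. g i (\<alpha> $ i)) = 0" by (intro prod_zero) auto
    qed
  qed
  then show ?thesis by (simp only: prod_sum_vec[OF finite_atMost])
qed

text \<open>At node \<open>\<gamma>\<close> only the indices below \<open>\<gamma>\<close> contribute, the sum over them factorizes, and in each coordinate
the increments telescope to univariate interpolation at the nodes up to \<open>\<gamma> i\<close>.\<close>
lemma tensor_lagrange_at_node:
  assumes "\<gamma> \<in> A"
  shows "tensor_lagrange A P \<beta> (grid_node P \<gamma>) = (if \<beta> = \<gamma> then 1 else 0)"
proof -
  have "tensor_lagrange A P \<beta> (grid_node P \<gamma>)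
      = (\<Prod>i\<in>UNIV. \<Sum>h\<le>\<gamma> $ i. poly (lagrange1_increment (P i) h (\<beta> $ i)) (P i (\<gamma> $ i)))"
    unfolding tensor_lagrange_def grid_node_def vec_lambda_beta
    by (rule sum_over_index_factorizes[OF assms, where g = "\<lambda>i h. poly (lagrange1_increment (P i) h (\<beta> $ i)) (P i (\<gamma> $ i))"])
      (use lagrange1_increment_at_earlier_node[OF inj] le_n in blast)
  also have "\<dots> = (\<Prod>i\<in>UNIV. if \<beta> $ i = \<gamma> $ i then 1 else 0)"
    unfolding poly_sum[symmetric] sum_lagrange1_increment
    using le_n[OF assms] by (intro prod.cong refl trunc_lagrange1_at_node[OF inj]) auto
  also have "\<dots> = (if \<beta> = \<gamma> then 1 else 0)"
    by (auto simp: vec_eq_iff)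
  finally show ?thesis .
qed

lemma tensor_lagrange_outside:
  assumes "\<beta> \<notin> A"
  shows "tensor_lagrange A P \<beta> x = 0"
  unfolding tensor_lagrange_def
proof (rule sum.neutral, rule ballI)
  fix \<alpha> assume "\<alpha> \<in> A"
  then obtain i where "\<alpha> $ i < \<beta> $ i"
    using assms downward_closedD[OF down, of \<alpha> \<beta>] by (meson not_le)
  then show "(\<Prod>i\<in>UNIV. poly (lagrange1_increment (P i) (\<alpha> $ i) (\<beta> $ i)) (x $ i)) = 0"
    by (intro prod_zero) (auto intro!: exI[of _ i] simp: lagrange1_increment_eq_0)
qed

lemma sum_tensor_lagrange_box:
  "(\<Sum>\<beta>\<in>A. g \<beta> * tensor_lagrange A P \<beta> x) = (\<Sum>\<beta> | \<forall>i. \<beta> $ i \<in> {..n}. g \<beta> * tensor_lagrange A P \<beta> x)"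
  by (intro sum.mono_neutral_left finite_vec_box) (auto simp: tensor_lagrange_outside le_n)

text \<open>The same mechanism as at a node: the increments of order above \<open>a i\<close> annihilate the \<open>a i\<close>-th power, so that
only indices below \<open>a\<close> contribute and the sum factorizes into univariate interpolations of powers.\<close>
lemma tensor_lagrange_reproduces_monomial:
  assumes "a \<in> A"
  shows "(\<Sum>\<beta>\<in>A. (\<Prod>i\<in>UNIV. (grid_node P \<beta> $ i) ^ (a $ i)) * tensor_lagrange A P \<beta> x)
    = (\<Prod>i\<in>UNIV. (x $ i) ^ (a $ i))"
proof -
  let ?s = "\<lambda>i h. \<Sum>j\<le>n. P i j ^ (a $ i) * poly (lagrange1_increment (P i) h j) (x $ i)"
  have "(\<Sum>\<beta>\<in>A. (\<Prod>i\<in>UNIV. (grid_node P \<beta> $ i) ^ (a $ i)) * tensor_lagrange A P \<beta> x)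
     = (\<Sum>\<alpha>\<in>A. \<Sum>\<beta> | \<forall>i. \<beta> $ i \<in> {..n}.
         \<Prod>i\<in>UNIV. P i (\<beta> $ i) ^ (a $ i) * poly (lagrange1_increment (P i) (\<alpha> $ i) (\<beta> $ i)) (x $ i))"
    unfolding sum_tensor_lagrange_box
    by (subst sum.swap) (simp add: tensor_lagrange_def grid_node_def sum_distrib_left prod.distrib)
  also have "\<dots> = (\<Sum>\<alpha>\<in>A. \<Prod>i\<in>UNIV. ?s i (\<alpha> $ i))"
    by (simp only: prod_sum_vec[OF finite_atMost])
  also have "\<dots> = (\<Prod>i\<in>UNIV. \<Sum>h\<le>a $ i. ?s i h)"
  proof (rule sum_over_index_factorizes[OF assms])
    fix \<alpha> i assume "\<alpha> \<in> A" "a $ i < \<alpha> $ i"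
    then show "?s i (\<alpha> $ i) = 0"
      using lagrange1_increment_annihilates[OF inj[of i] le_n[of \<alpha> i], of "monom 1 (a $ i)"]
      by (simp add: poly_monom degree_monom_eq)
  qed
  also have "\<dots> = (\<Prod>i\<in>UNIV. (x $ i) ^ (a $ i))"
  proof (rule prod.cong[OF refl])
    fix i
    have "(\<Sum>h\<le>a $ i. ?s i h) = (\<Sum>j\<le>n. poly (monom 1 (a $ i)) (P i j) * poly (trunc_lagrange1 (P i) (Suc (a $ i)) j) (x $ i))"
      by (subst sum.swap) (simp add: sum_distrib_left[symmetric] poly_sum[symmetric] sum_lagrange1_increment poly_monom)
    also have "\<dots> = poly (monom 1 (a $ i)) (x $ i)"
      using le_n[OF assms] by (intro trunc_lagrange1_reproduces[OF inj]) (auto simp: degree_monom_eq)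
    finally show "(\<Sum>h\<le>a $ i. ?s i h) = (x $ i) ^ (a $ i)" by (simp add: poly_monom)
  qed
  finally show ?thesis .
qed

lemma tensor_lagrange_reproduces:
  assumes "q \<in> poly_space A"
  shows "q x = (\<Sum>\<beta>\<in>A. q (grid_node P \<beta>) * tensor_lagrange A P \<beta> x)"
proof -
  obtain c where c: "q = (\<lambda>x. \<Sum>\<alpha>\<in>A. c \<alpha> * (\<Prod>i\<in>UNIV. (x $ i) ^ (\<alpha> $ i)))"
    using assms by (auto simp: poly_space_def)
  have "(\<Sum>\<beta>\<in>A. q (grid_node P \<beta>) * tensor_lagrange A P \<beta> x)
     = (\<Sum>\<alpha>\<in>A. c \<alpha> * (\<Sum>\<beta>\<in>A. (\<Prod>i\<in>UNIV. (grid_node P \<beta> $ i) ^ (\<alpha> $ i)) * tensor_lagrange A P \<beta> x))"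
    unfolding c sum_distrib_right sum_distrib_left
    by (subst sum.swap) (simp add: mult.assoc)
  also have "\<dots> = q x"
    unfolding c by (intro sum.cong refl) (simp add: tensor_lagrange_reproduces_monomial)
  finally show ?thesis by simp
qed

text \<open>Since interpolation reproduces \<open>poly_space A\<close>, its elements are determined by their values at the grid;
no count of dimensions is involved.\<close>
lemma interpolation_unique:
  assumes "q \<in> poly_space A" "\<And>\<alpha>. \<alpha> \<in> A \<Longrightarrow> q (grid_node P \<alpha>) = v \<alpha>"
  shows "q = (\<lambda>x. \<Sum>\<alpha>\<in>A. v \<alpha> * tensor_lagrange A P \<alpha> x)"
proof
  fix x
  have "q x = (\<Sum>\<alpha>\<in>A. q (grid_node P \<alpha>) * tensor_lagrange A P \<alpha> x)"
    by (rule tensor_lagrange_reproduces[OF assms(1)])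
  then show "q x = (\<Sum>\<alpha>\<in>A. v \<alpha> * tensor_lagrange A P \<alpha> x)"
    by (simp only: assms(2) cong: sum.cong)
qed

lemma interpolation_exists:
  "(\<lambda>x. \<Sum>\<alpha>\<in>A. v \<alpha> * tensor_lagrange A P \<alpha> x) \<in> poly_space A"
  "\<gamma> \<in> A \<Longrightarrow> (\<Sum>\<alpha>\<in>A. v \<alpha> * tensor_lagrange A P \<alpha> (grid_node P \<gamma>)) = v \<gamma>"
  using finite_index
  by (auto intro!: poly_space_sum tensor_lagrange_in_poly_space
      simp: tensor_lagrange_at_node if_distrib[of "(*) _"] cong: if_cong)

lemma the_interpolation:
  "(THE q. q \<in> poly_space A \<and> (\<forall>\<alpha>\<in>A. q (grid_node P \<alpha>) = v \<alpha>))
    = (\<lambda>x. \<Sum>\<alpha>\<in>A. v \<alpha> * tensor_lagrange A P \<alpha> x)"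
  by (rule the_equality) (auto intro: interpolation_exists interpolation_unique)

lemma lagrange_eq_tensor_lagrange:
  assumes "\<beta> \<in> A"
  shows "lagrange A P \<beta> = tensor_lagrange A P \<beta>"
proof -
  have "lagrange A P \<beta> = (\<lambda>x. \<Sum>\<alpha>\<in>A. (if \<beta> = \<alpha> then 1 else 0) * tensor_lagrange A P \<alpha> x)"
    unfolding lagrange_def by (rule the_interpolation)
  also have "\<dots> = (\<lambda>x. \<Sum>\<alpha>\<in>A. if \<beta> = \<alpha> then tensor_lagrange A P \<alpha> x else 0)"
    by (intro ext sum.cong) auto
  finally show ?thesis using assms finite_index by simp
qed

lemma lagrange_in_poly_space: "\<alpha> \<in> A \<Longrightarrow> lagrange A P \<alpha> \<in> poly_space A"
  by (simp add: lagrange_eq_tensor_lagrange tensor_lagrange_in_poly_space)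

lemma lagrange_reproduces:
  assumes "q \<in> poly_space A"
  shows "q x = (\<Sum>\<alpha>\<in>A. q (grid_node P \<alpha>) * lagrange A P \<alpha> x)"
  using tensor_lagrange_reproduces[OF assms, of x]
  by (simp only: lagrange_eq_tensor_lagrange cong: sum.cong)

lemma interpolant_eq: "interpolant A P f x = (\<Sum>\<alpha>\<in>A. f (grid_node P \<alpha>) * lagrange A P \<alpha> x)"
  unfolding interpolant_def the_interpolation by (simp add: lagrange_eq_tensor_lagrange)

text \<open>Each of the \<open>card A\<close> tensor products of increments has norm at most \<open>(2 * B) ^ m\<close>, whichever order
its factors have.\<close>
lemma sum_abs_lagrange_le:
  assumes "\<And>i h. h \<le> n \<Longrightarrow> lebesgue_const1 (P i) h \<le> B" "x \<in> cube"
  shows "(\<Sum>\<alpha>\<in>A. \<bar>lagrange A P \<alpha> x\<bar>) \<le> (real n + 1) ^ CARD('m) * (2 * B) ^ CARD('m)"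
proof -
  have x: "x $ i \<in> {-1..1}" for i using assms(2) by (simp add: cube_def)
  let ?d = "\<lambda>i h j. \<bar>poly (lagrange1_increment (P i) h j) (x $ i)\<bar>"
  have B: "0 \<le> B"
  proof -
    fix i
    have "0 \<le> (\<Sum>j\<le>n. ?d i n j)" by (simp add: sum_nonneg)
    also have "\<dots> \<le> 2 * B" using assms(1) x by (intro sum_abs_lagrange1_increment_le) auto
    finally show ?thesis by simp
  qed
  have "(\<Sum>\<alpha>\<in>A. \<bar>lagrange A P \<alpha> x\<bar>) = (\<Sum>\<beta>\<in>A. \<bar>\<Sum>\<alpha>\<in>A. \<Prod>i\<in>UNIV. poly (lagrange1_increment (P i) (\<alpha> $ i) (\<beta> $ i)) (x $ i)\<bar>)"
    by (simp add: lagrange_eq_tensor_lagrange tensor_lagrange_def)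
  also have "\<dots> \<le> (\<Sum>\<beta>\<in>A. \<Sum>\<alpha>\<in>A. \<Prod>i\<in>UNIV. ?d i (\<alpha> $ i) (\<beta> $ i))"
    unfolding abs_prod[symmetric] by (intro sum_mono sum_abs)
  also have "\<dots> = (\<Sum>\<alpha>\<in>A. \<Sum>\<beta>\<in>A. \<Prod>i\<in>UNIV. ?d i (\<alpha> $ i) (\<beta> $ i))"
    by (rule sum.swap)
  also have "\<dots> \<le> (\<Sum>\<alpha>\<in>A. \<Sum>\<beta> | \<forall>i. \<beta> $ i \<in> {..n}. \<Prod>i\<in>UNIV. ?d i (\<alpha> $ i) (\<beta> $ i))"
    by (intro sum_mono sum_mono2 finite_vec_box) (auto intro: le_n prod_nonneg)
  also have "\<dots> = (\<Sum>\<alpha>\<in>A. \<Prod>i\<in>UNIV. \<Sum>j\<le>n. ?d i (\<alpha> $ i) j)"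
    by (simp only: prod_sum_vec[OF finite_atMost])
  also have "\<dots> \<le> (\<Sum>\<alpha>\<in>A. \<Prod>i\<in>(UNIV :: 'm set). 2 * B)"
    using assms(1) x le_n
    by (intro sum_mono prod_mono conjI sum_abs_lagrange1_increment_le sum_nonneg) auto
  also have "\<dots> = real (card A) * (2 * B) ^ CARD('m)" by simp
  also have "\<dots> \<le> (real n + 1) ^ CARD('m) * (2 * B) ^ CARD('m)"
  proof (rule mult_right_mono)
    have "real (card A) \<le> real ((n + 1) ^ CARD('m))" using card_index_le by (rule of_nat_mono)
    then show "real (card A) \<le> (real n + 1) ^ CARD('m)" by (simp add: add.commute)
  qed (use B in simp)
  finally show ?thesis .
qed

end

section \<open>Partial derivatives of polynomials on the cube\<close>

lemma cube_coord: "x \<in> cube \<Longrightarrow> x $ i \<in> {-1..1}"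
  by (simp add: cube_def)

lemma cube_replace_coord: "x \<in> cube \<Longrightarrow> t \<in> {-1..1} \<Longrightarrow> (\<chi> j. if j = i then t else x $ j) \<in> cube"
  by (simp add: cube_def)

lemma replace_coord_same [simp]: "(\<chi> j. if j = i then x $ i else x $ j) = x"
  by (simp add: vec_eq_iff)

lemma zero_in_cube: "0 \<in> cube" by (simp add: cube_def)

lemma compact_cube: "compact (cube :: (real ^ 'm::finite) set)"
proof -
  have "(cube :: (real ^ 'm) set) = cbox (\<chi> i. -1) (\<chi> i. 1)"
    by (auto simp: cube_def mem_box_cart)
  then show ?thesis by (metis compact_cbox)
qed

text \<open>The coordinate interval is nondegenerate, so one-sided derivatives at its endpoints are unique.\<close>
lemma partial_eqI:
  assumes "x \<in> cube" "(coord_line i g x has_vector_derivative D) (at (x $ i) within {-1..1})"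
  shows "partial i g x = D"
  unfolding partial_def
  using cube_coord[OF assms(1)] assms(2) by (intro vector_derivative_within_closed_interval) auto

lemma has_partial_transform:
  assumes "x \<in> cube" "\<And>y. y \<in> cube \<Longrightarrow> g y = h y"
    "(coord_line i h x has_vector_derivative D) (at (x $ i) within {-1..1})"
  shows "(coord_line i g x has_vector_derivative D) (at (x $ i) within {-1..1})"
  by (rule has_vector_derivative_transform[OF cube_coord[OF assms(1)] _ assms(3)])
    (simp add: coord_line_def assms(2) cube_replace_coord[OF assms(1)])

text \<open>Bounding the degree in each coordinate separately is enough for the derivative estimates, and it makes them
independent of the exponent of the norm that defines the index sets.\<close>
definition index_box :: "nat \<Rightarrow> (nat ^ 'm) set"
  where "index_box n = {\<alpha>. \<forall>i. \<alpha> $ i \<in> {..n}}"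

lemma finite_index_box: "finite (index_box n :: (nat ^ 'm::finite) set)"
  unfolding index_box_def by (intro finite_vec_box) auto

text \<open>Along each coordinate line \<open>q\<close> is a univariate polynomial \<open>u\<close> of degree at most \<open>n\<close>. The
existential quantifier over \<open>u\<close> keeps exactly what the univariate Markov inequality consumes.\<close>
lemma poly_space_box_partial:
  fixes q :: "real ^ 'm::finite \<Rightarrow> real"
  assumes "q \<in> poly_space (index_box n)"
  obtains Dq where "Dq \<in> poly_space (index_box n)"
    "\<And>x. \<exists>u. degree u \<le> n \<and> (\<forall>t. coord_line i q x t = poly u t) \<and> Dq x = poly (pderiv u) (x $ i)"
proof -
  obtain c where c: "q = (\<lambda>x. \<Sum>\<alpha>\<in>index_box n. c \<alpha> * (\<Prod>j\<in>UNIV. (x $ j) ^ (\<alpha> $ j)))"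
    using assms by (auto simp: poly_space_def)
  \<comment> \<open>The exponent after one differentiation. In coordinate exponent 0 the truncated subtraction is harmless,
    because the coefficient vanishes.\<close>
  define low where "low = (\<lambda>\<alpha> :: nat ^ 'm. \<chi> j. if j = i then \<alpha> $ i - 1 else \<alpha> $ j)"
  define Dq where "Dq = (\<lambda>x :: real ^ 'm. \<Sum>\<alpha>\<in>index_box n. c \<alpha> * (real (\<alpha> $ i) * (\<Prod>j\<in>UNIV. (x $ j) ^ (low \<alpha> $ j))))"
  have "Dq \<in> poly_space (index_box n)"
    unfolding Dq_def
  proof (intro poly_space_sum monomial_in_poly_space finite_index_box)
    fix \<alpha> :: "nat ^ 'm" assume a: "\<alpha> \<in> index_box n"
    have "low \<alpha> $ j \<le> n" for j
    proof -
      have "low \<alpha> $ j \<le> \<alpha> $ j" by (simp add: low_def)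
      also have "\<dots> \<le> n" using a by (simp add: index_box_def)
      finally show ?thesis .
    qed
    then show "low \<alpha> \<in> index_box n" by (simp add: index_box_def)
  qed
  moreover have "\<exists>u. degree u \<le> n \<and> (\<forall>t. coord_line i q x t = poly u t) \<and> Dq x = poly (pderiv u) (x $ i)" for x
  proof (intro exI conjI allI)
    let ?r = "\<lambda>\<alpha> :: nat ^ 'm. \<Prod>j\<in>UNIV - {i}. (x $ j) ^ (\<alpha> $ j)"
    let ?u = "\<Sum>\<alpha>\<in>index_box n. monom (c \<alpha> * ?r \<alpha>) (\<alpha> $ i)"
    show "degree ?u \<le> n"
      by (rule degree_sum_le[OF finite_index_box]) (auto simp: index_box_def intro: order.trans[OF degree_monom_le])
    show "coord_line i q x t = poly ?u t" for t
    proof -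
      have "(\<Prod>j\<in>UNIV. (if j = i then t else x $ j) ^ (\<alpha> $ j)) = t ^ (\<alpha> $ i) * ?r \<alpha>" for \<alpha> :: "nat ^ 'm"
        by (subst prod.remove[of UNIV i]) (auto intro!: prod.cong)
      then show ?thesis by (simp add: coord_line_def c poly_sum poly_monom mult_ac)
    qed
    have "(\<Prod>j\<in>UNIV. (x $ j) ^ (low \<alpha> $ j)) = (x $ i) ^ (\<alpha> $ i - 1) * ?r \<alpha>" for \<alpha> :: "nat ^ 'm"
      by (subst prod.remove[of UNIV i]) (auto simp: low_def intro!: prod.cong)
    then show "Dq x = poly (pderiv ?u) (x $ i)"
      by (simp add: Dq_def higher_pderiv_sum[of 1, simplified] poly_sum pderiv_monom poly_monom mult_ac)
  qed
  ultimately show ?thesis using that by blast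
qed

text \<open>Polynomials are only required to coincide with \<open>g\<close> on the cube, because partial derivatives are defined along
segments inside the cube and say nothing useful at other points.\<close>
definition cube_poly :: "nat \<Rightarrow> (real ^ 'm::finite \<Rightarrow> real) \<Rightarrow> bool"
  where "cube_poly n g \<longleftrightarrow> (\<exists>q\<in>poly_space (index_box n). \<forall>x\<in>cube. g x = q x)"

lemma cube_poly_mono:
  assumes "cube_poly k g" "k \<le> n"
  shows "cube_poly n g"
proof -
  have "poly_space (index_box k) \<subseteq> (poly_space (index_box n) :: (real ^ 'a \<Rightarrow> real) set)"
    using assms(2) by (intro poly_space_mono finite_index_box) (auto simp: index_box_def intro: order.trans)
  then show ?thesis using assms(1) unfolding cube_poly_def by blast
qed

lemma cube_poly_sum:
  assumes "\<And>j. j \<in> J \<Longrightarrow> cube_poly n (g j)"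
  shows "cube_poly n (\<lambda>x. \<Sum>j\<in>J. c j * g j x)"
proof -
  have "\<forall>j\<in>J. \<exists>q. q \<in> poly_space (index_box n) \<and> (\<forall>x\<in>cube. g j x = q x)"
    using assms by (auto simp: cube_poly_def)
  from bchoice[OF this] obtain q where q: "\<And>j. j \<in> J \<Longrightarrow> q j \<in> poly_space (index_box n)"
    "\<And>j x. j \<in> J \<Longrightarrow> x \<in> cube \<Longrightarrow> g j x = q j x" by blast
  show ?thesis
    unfolding cube_poly_def
    by (rule bexI[where x = "\<lambda>x. \<Sum>j\<in>J. c j * q j x"])
      (use q in \<open>auto intro!: poly_space_sum sum.cong\<close>)
qed

lemma cube_poly_diff:
  assumes "cube_poly n g" "cube_poly n h"
  shows "cube_poly n (\<lambda>x. g x - h x)"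
  using cube_poly_sum[of UNIV n "\<lambda>b. if b then g else h" "\<lambda>b. if b then 1 else -1"] assms
  by (simp add: UNIV_bool)

lemma cube_poly_continuous:
  assumes "cube_poly n g"
  shows "continuous_on cube g"
proof -
  obtain c where c: "\<And>x. x \<in> cube \<Longrightarrow> g x = (\<Sum>\<alpha>\<in>index_box n. c \<alpha> * (\<Prod>i\<in>UNIV. (x $ i) ^ (\<alpha> $ i)))"
    using assms by (auto simp: cube_poly_def poly_space_def)
  show ?thesis
    by (subst continuous_on_cong[OF refl c], assumption) (intro continuous_intros)
qed

lemma cube_poly_partial:
  assumes "cube_poly n g"
  shows "cube_poly n (partial i g)"
    and "x \<in> cube \<Longrightarrow> (coord_line i g x has_vector_derivative partial i g x) (at (x $ i) within {-1..1})"
    and "(\<And>x. x \<in> cube \<Longrightarrow> \<bar>g x\<bar> \<le> M) \<Longrightarrow> x \<in> cube \<Longrightarrow> \<bar>partial i g x\<bar> \<le> 2 * real n ^ 2 * M"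
proof -
  obtain q where q: "q \<in> poly_space (index_box n)" "\<And>x. x \<in> cube \<Longrightarrow> g x = q x"
    using assms by (auto simp: cube_poly_def)
  obtain Dq where Dq: "Dq \<in> poly_space (index_box n)"
    "\<And>x. \<exists>u. degree u \<le> n \<and> (\<forall>t. coord_line i q x t = poly u t) \<and> Dq x = poly (pderiv u) (x $ i)"
    using poly_space_box_partial[OF q(1), of i] by blast
  have hvd: "(coord_line i g x has_vector_derivative Dq x) (at (x $ i) within {-1..1})" if x: "x \<in> cube" for x
  proof -
    obtain u where u: "\<And>t. coord_line i q x t = poly u t" "Dq x = poly (pderiv u) (x $ i)"
      using Dq(2)[of x] by blast
    have "coord_line i q x = poly u" using u(1) by (intro ext)
    then have "(coord_line i q x has_vector_derivative Dq x) (at (x $ i) within {-1..1})"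
      using poly_DERIV[of u "x $ i"] u(2)
      by (auto simp: has_real_derivative_iff_has_vector_derivative intro: has_vector_derivative_at_within)
    with x q(2) show ?thesis by (rule has_partial_transform)
  qed
  have eq: "partial i g x = Dq x" if "x \<in> cube" for x
    using that hvd[OF that] by (rule partial_eqI)
  show "cube_poly n (partial i g)"
    using Dq(1) eq by (auto simp: cube_poly_def)
  show "(coord_line i g x has_vector_derivative partial i g x) (at (x $ i) within {-1..1})" if "x \<in> cube"
    using hvd[OF that] eq[OF that] by simp
  show "\<bar>partial i g x\<bar> \<le> 2 * real n ^ 2 * M" if M: "\<And>x. x \<in> cube \<Longrightarrow> \<bar>g x\<bar> \<le> M" and x: "x \<in> cube"
  proof -
    obtain u where u: "degree u \<le> n" "\<And>t. coord_line i q x t = poly u t" "Dq x = poly (pderiv u) (x $ i)"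
      using Dq(2)[of x] by blast
    have "\<bar>poly u t\<bar> \<le> M" if "t \<in> {-1..1}" for t
      using M[OF cube_replace_coord[OF x that, of i]] q(2)[OF cube_replace_coord[OF x that, of i]] u(2)[of t]
      by (simp add: coord_line_def)
    then show ?thesis
      unfolding eq[OF x] u(3) using u(1) cube_coord[OF x] by (intro markov_inequality)
  qed
qed

section \<open>Smooth functions and mixed partial derivatives\<close>

definition cube_smooth :: "(real ^ 'm \<Rightarrow> real) \<Rightarrow> bool"
  where "cube_smooth g \<longleftrightarrow> (\<forall>k. Ck_on_cube k g)"

text \<open>Smoothness of a whole class of functions follows once the class is closed under partial derivatives.\<close>
lemma cube_smooth_coinduct:
  assumes "R g"
    and "\<And>g. R g \<Longrightarrow> continuous_on cube g"
    and "\<And>g i x. R g \<Longrightarrow> x \<in> cube \<Longrightarrow> coord_line i g x differentiable (at (x $ i) within {-1..1})"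
    and "\<And>g i. R g \<Longrightarrow> R (partial i g)"
  shows "cube_smooth g"
proof -
  have "Ck_on_cube k g" if "R g" for k g
    using that by (induction k arbitrary: g) (auto intro: assms(2-4))
  then show ?thesis using assms(1) by (auto simp: cube_smooth_def)
qed

lemma cube_smooth_partial: "cube_smooth g \<Longrightarrow> cube_smooth (partial i g)"
  unfolding cube_smooth_def by (metis Ck_on_cube.simps(2))

lemma cube_smooth_has_partial:
  assumes "cube_smooth g" "x \<in> cube"
  shows "(coord_line i g x has_vector_derivative partial i g x) (at (x $ i) within {-1..1})"
proof -
  have "Ck_on_cube (Suc 0) g" using assms(1) by (simp only: cube_smooth_def)
  then show ?thesis using assms(2) by (simp add: partial_def vector_derivative_works)
qed

lemma cube_poly_smooth:
  assumes "cube_poly n g"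
  shows "cube_smooth g"
  using assms
proof (rule cube_smooth_coinduct[where R = "cube_poly n"])
  fix g :: "real ^ 'a \<Rightarrow> real" and i and x :: "real ^ 'a" assume "cube_poly n g" "x \<in> cube"
  then show "coord_line i g x differentiable (at (x $ i) within {-1..1})"
    using cube_poly_partial(2) differentiableI_vector by blast
qed (auto intro: cube_poly_continuous cube_poly_partial(1))

lemma partial_sum:
  assumes "\<And>j. j \<in> J \<Longrightarrow> cube_smooth (G j)" "\<And>x. x \<in> cube \<Longrightarrow> g x = (\<Sum>j\<in>J. c j * G j x)" "x \<in> cube"
  shows "partial i g x = (\<Sum>j\<in>J. c j * partial i (G j) x)"
proof (rule partial_eqI[OF assms(3)], rule has_partial_transform[OF assms(3,2)])
  have "((\<lambda>t. \<Sum>j\<in>J. c j * coord_line i (G j) x t) has_vector_derivative (\<Sum>j\<in>J. c j * partial i (G j) x))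
      (at (x $ i) within {-1..1})"
    using cube_smooth_has_partial[OF assms(1) assms(3)]
    by (intro has_vector_derivative_sum has_vector_derivative_mult_right) auto
  then show "(coord_line i (\<lambda>x. \<Sum>j\<in>J. c j * G j x) x has_vector_derivative (\<Sum>j\<in>J. c j * partial i (G j) x))
      (at (x $ i) within {-1..1})"
    by (simp add: coord_line_def[abs_def])
qed

lemma funpow_partial_induct:
  assumes "R e g G" "\<And>e g G. R e g G \<Longrightarrow> R (Suc e) (partial i g) (\<lambda>j. partial i (G j))"
  shows "R (e + k) ((partial i ^^ k) g) (\<lambda>j. (partial i ^^ k) (G j))"
  by (induction k) (auto intro: assms)

text \<open>Mixed derivatives are iterated partial derivatives, so a relation between a function and a family of functions
that survives one simultaneous partial derivative survives all of them; the counter \<open>e\<close> records their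
number. The family is there to treat linear combinations and approximating sequences alike.\<close>
lemma mpartial_induct:
  fixes g :: "real ^ 'm::{finite,linorder} \<Rightarrow> real" and G :: "'j \<Rightarrow> real ^ 'm::{finite,linorder} \<Rightarrow> real"
  assumes "R 0 g G" "\<And>e i g G. R e g G \<Longrightarrow> R (Suc e) (partial i g) (\<lambda>j. partial i (G j))"
  shows "R (\<Sum>i\<in>UNIV. \<beta> $ i) (mpartial \<beta> g) (\<lambda>j. mpartial \<beta> (G j))"
proof -
  have "R (\<Sum>i\<in>set xs. \<beta> $ i) (foldr (\<lambda>i. partial i ^^ (\<beta> $ i)) xs g)
      (\<lambda>j. foldr (\<lambda>i. partial i ^^ (\<beta> $ i)) xs (G j))" if "distinct xs" for xs
    using that
  proof (induction xs)
    case (Cons i xs)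
    then have "R ((\<Sum>i\<in>set xs. \<beta> $ i) + \<beta> $ i)
       ((partial i ^^ (\<beta> $ i)) (foldr (\<lambda>i. partial i ^^ (\<beta> $ i)) xs g))
       (\<lambda>j. (partial i ^^ (\<beta> $ i)) (foldr (\<lambda>i. partial i ^^ (\<beta> $ i)) xs (G j)))"
      by (intro funpow_partial_induct[where R = R] assms(2)) auto
    then show ?case using Cons.prems by (simp add: add.commute)
  qed (simp add: assms(1))
  from this[of "sorted_list_of_set UNIV"] show ?thesis by (simp add: mpartial_def)
qed

lemma mpartial_sum:
  assumes "\<And>j. j \<in> J \<Longrightarrow> cube_smooth (G j)" "\<And>x. x \<in> cube \<Longrightarrow> g x = (\<Sum>j\<in>J. c j * G j x)" "x \<in> cube"
  shows "mpartial \<beta> g x = (\<Sum>j\<in>J. c j * mpartial \<beta> (G j) x)"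
proof -
  let ?R = "\<lambda>_ g G. (\<forall>j\<in>J. cube_smooth (G j)) \<and> (\<forall>x\<in>cube. g x = (\<Sum>j\<in>J. c j * G j x))"
  have "?R (\<Sum>i\<in>UNIV. \<beta> $ i) (mpartial \<beta> g) (\<lambda>j. mpartial \<beta> (G j))"
  proof (rule mpartial_induct[where R = ?R])
    show "(\<forall>j\<in>J. cube_smooth (G j)) \<and> (\<forall>x\<in>cube. g x = (\<Sum>j\<in>J. c j * G j x))"
      using assms(1,2) by blast
    fix i g G assume "(\<forall>j\<in>J. cube_smooth (G j)) \<and> (\<forall>x\<in>cube. g x = (\<Sum>j\<in>J. c j * G j x))"
    then show "(\<forall>j\<in>J. cube_smooth (partial i (G j))) \<and>
        (\<forall>x\<in>cube. partial i g x = (\<Sum>j\<in>J. c j * partial i (G j) x))"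
      using partial_sum[of J G g c _ i] cube_smooth_partial by blast
  qed
  then show ?thesis using assms(3) by blast
qed

lemma mpartial_diff:
  assumes "cube_smooth g" "cube_smooth h" "x \<in> cube"
  shows "mpartial \<beta> (\<lambda>x. g x - h x) x = mpartial \<beta> g x - mpartial \<beta> h x"
  using mpartial_sum[of UNIV "\<lambda>b. if b then g else h" "\<lambda>x. g x - h x" "\<lambda>b. if b then 1 else -1" x \<beta>] assms
  by (simp add: UNIV_bool)

lemma mpartial_cube_poly:
  assumes "cube_poly n g"
  shows "cube_poly n (mpartial \<beta> g)"
    and "(\<And>x. x \<in> cube \<Longrightarrow> \<bar>g x\<bar> \<le> M) \<Longrightarrow> x \<in> cube \<Longrightarrow> \<bar>mpartial \<beta> g x\<bar> \<le> (2 * real n ^ 2) ^ (\<Sum>i\<in>UNIV. \<beta> $ i) * M"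
proof -
  show "cube_poly n (mpartial \<beta> g)"
    using mpartial_induct[where R = "\<lambda>_ g (_ :: unit \<Rightarrow> _). cube_poly n g" and g = g and G = "\<lambda>_. g" and \<beta> = \<beta>]
      assms cube_poly_partial(1) by blast
  assume M: "\<And>x. x \<in> cube \<Longrightarrow> \<bar>g x\<bar> \<le> M" and x: "x \<in> cube"
  let ?R = "\<lambda>e g (_ :: unit \<Rightarrow> real ^ 'a::{finite,linorder} \<Rightarrow> real). cube_poly n g \<and> (\<forall>x\<in>cube. \<bar>g x\<bar> \<le> (2 * real n ^ 2) ^ e * M)"
  have "?R (\<Sum>i\<in>UNIV. \<beta> $ i) (mpartial \<beta> g) (\<lambda>_. mpartial \<beta> g)"
  proof (rule mpartial_induct[where R = ?R])
    show "cube_poly n g \<and> (\<forall>x\<in>cube. \<bar>g x\<bar> \<le> (2 * real n ^ 2) ^ 0 * M)"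
      using assms M by simp
    fix e i and g :: "real ^ 'a::{finite,linorder} \<Rightarrow> real"
    assume "cube_poly n g \<and> (\<forall>x\<in>cube. \<bar>g x\<bar> \<le> (2 * real n ^ 2) ^ e * M)"
    then show "cube_poly n (partial i g) \<and> (\<forall>x\<in>cube. \<bar>partial i g x\<bar> \<le> (2 * real n ^ 2) ^ Suc e * M)"
      using cube_poly_partial(1)[of n g i] cube_poly_partial(3)[of n g "(2 * real n ^ 2) ^ e * M" _ i]
      by (simp add: mult.assoc)
  qed
  then show "\<bar>mpartial \<beta> g x\<bar> \<le> (2 * real n ^ 2) ^ (\<Sum>i\<in>UNIV. \<beta> $ i) * M" using x by blast
qed

lemma mpartial_axis:
  "mpartial (\<chi> i. if i = i0 then k else 0) g = (partial i0 ^^ k) g"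
proof -
  have "foldr (\<lambda>i. partial i ^^ (if i = i0 then k else 0)) xs g = (if i0 \<in> set xs then (partial i0 ^^ k) g else g)"
    if "distinct xs" for xs
    using that by (induction xs) auto
  from this[of "sorted_list_of_set UNIV"] show ?thesis by (simp add: mpartial_def)
qed

lemma funpow_partial_univariate:
  assumes "x \<in> cube"
  shows "(partial i ^^ k) (\<lambda>x. poly u (x $ i)) x = poly ((pderiv ^^ k) u) (x $ i)"
  using assms
proof (induction k arbitrary: x)
  case (Suc k)
  have "partial i ((partial i ^^ k) (\<lambda>x. poly u (x $ i))) x = poly (pderiv ((pderiv ^^ k) u)) (x $ i)"
  proof (rule partial_eqI[OF Suc.prems], rule has_partial_transform[OF Suc.prems Suc.IH])
    show "(coord_line i (\<lambda>x. poly ((pderiv ^^ k) u) (x $ i)) x has_vector_derivative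
        poly (pderiv ((pderiv ^^ k) u)) (x $ i)) (at (x $ i) within {-1..1})"
      using poly_DERIV[of "(pderiv ^^ k) u" "x $ i"]
      by (auto simp: coord_line_def[abs_def] has_real_derivative_iff_has_vector_derivative
          intro: has_vector_derivative_at_within)
  qed
  then show ?case by simp
qed simp

section \<open>Geometric approximation with polynomial loss\<close>

text \<open>Ratio test: the quotients of successive terms tend to \<open>\<rho>\<close>.\<close>
lemma summable_poly_over_exp:
  fixes \<rho> :: real
  assumes "1 < \<rho>"
  shows "summable (\<lambda>j. (real j + 1) ^ E / \<rho> ^ j)"
proof (rule ratio_test_convergence)
  let ?a = "\<lambda>j. (real j + 1) ^ E / \<rho> ^ j"
  show "\<forall>\<^sub>F j in sequentially. 0 < ?a j"
    using assms by (intro always_eventually) auto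
  have "(\<lambda>j. (real (Suc j) / real (Suc (Suc j))) ^ E * \<rho>) \<longlonglongrightarrow> 1 ^ E * \<rho>"
    by (intro tendsto_intros LIMSEQ_Suc[OF LIMSEQ_n_over_Suc_n])
  moreover have "(\<lambda>j. (real (Suc j) / real (Suc (Suc j))) ^ E * \<rho>) = (\<lambda>j. ?a j / ?a (Suc j))"
    using assms by (auto simp: power_divide add.commute)
  ultimately have "(\<lambda>j. ereal (?a j / ?a (Suc j))) \<longlonglongrightarrow> ereal \<rho>"
    by (intro tendsto_intros) simp
  then have "liminf (\<lambda>j. ereal (?a j / ?a (Suc j))) = ereal \<rho>"
    by (rule lim_imp_Liminf[OF trivial_limit_sequentially])
  then show "1 < liminf (\<lambda>j. ereal (?a j / ?a (Suc j)))"
    using assms by simp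
qed

text \<open>The tail of the series of increments is estimated through
\<open>(n + j + 1) ^ E \<le> (n + 1) ^ E * (j + 1) ^ E\<close>, which separates the dependence on \<open>n\<close> from a convergent series.\<close>
lemma limit_rate_of_increments:
  fixes a :: "nat \<Rightarrow> real"
  assumes "1 < \<rho>" "\<And>j. \<bar>a (Suc j) - a j\<bar> \<le> K * (real j + 1) ^ E / \<rho> ^ j"
  shows "\<bar>lim a - a n\<bar> \<le> K * (\<Sum>j. (real j + 1) ^ E / \<rho> ^ j) * (real n + 1) ^ E / \<rho> ^ n"
proof -
  have K: "0 \<le> K"
    using order.trans[OF abs_ge_zero assms(2)[of 0]] by simp
  define b where "b = (\<lambda>j. a (Suc (n + j)) - a (n + j))"
  define s where "s = (\<lambda>j. (real j + 1) ^ E / \<rho> ^ j)"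
  define w where "w = K * (real n + 1) ^ E / \<rho> ^ n"
  have s: "summable s" unfolding s_def using assms(1) by (rule summable_poly_over_exp)
  have bs: "norm (b j) \<le> w * s j" for j
  proof -
    have "real (n + j) + 1 \<le> (real n + 1) * (real j + 1)" by (simp add: algebra_simps)
    then have "(real (n + j) + 1) ^ E \<le> ((real n + 1) * (real j + 1)) ^ E" by (intro power_mono) auto
    then have "K * (real (n + j) + 1) ^ E / \<rho> ^ (n + j) \<le> K * ((real n + 1) * (real j + 1)) ^ E / \<rho> ^ (n + j)"
      using K assms(1) by (intro divide_right_mono mult_left_mono) auto
    also have "\<dots> = w * s j" by (simp add: w_def s_def power_mult_distrib power_add)
    finally show ?thesis using assms(2)[of "n + j"] by (simp add: b_def)
  qed
  have sb: "summable b" by (rule summable_comparison_test[of b "\<lambda>j. w * s j"]) (use bs s in \<open>auto intro: summable_mult\<close>)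
  have "(\<lambda>m. \<Sum>j<m. b j) = (\<lambda>m. a (n + m) - a n)"
    using sum_lessThan_telescope[of "\<lambda>m. a (n + m)"] by (simp add: b_def)
  then have "(\<lambda>m. a (n + m) - a n) \<longlonglongrightarrow> suminf b"
    using summable_LIMSEQ[OF sb] by simp
  then have "(\<lambda>m. (a (n + m) - a n) + a n) \<longlonglongrightarrow> suminf b + a n" by (intro tendsto_intros)
  then have "(\<lambda>m. a (m + n)) \<longlonglongrightarrow> suminf b + a n" by (simp add: add.commute)
  then have "a \<longlonglongrightarrow> suminf b + a n" by (rule LIMSEQ_offset)
  then have "lim a - a n = suminf b" by (simp add: limI)
  also have "norm (suminf b) \<le> (\<Sum>j. w * s j)"
    using bs s by (intro norm_suminf_le summable_mult)
  also have "(\<Sum>j. w * s j) = w * suminf s" using s by (rule suminf_mult)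
  finally show ?thesis by (simp add: w_def s_def mult_ac)
qed

text \<open>Geometric approximation with a polynomial loss of exponent \<open>e\<close>. This class is stable under
partial derivatives, in contrast to geometric approximation without loss.\<close>
definition approx_rate :: "real \<Rightarrow> nat \<Rightarrow> (real ^ 'm::finite \<Rightarrow> real) \<Rightarrow> (nat \<Rightarrow> real ^ 'm \<Rightarrow> real) \<Rightarrow> bool"
  where "approx_rate \<rho> e g r \<longleftrightarrow> (\<forall>n. cube_poly n (r n)) \<and>
    (\<exists>C. \<forall>n. \<forall>x\<in>cube. \<bar>g x - r n x\<bar> \<le> C * (real n + 1) ^ e / \<rho> ^ n)"

lemma approx_rate_tendsto_0:
  fixes \<rho> :: real
  assumes "1 < \<rho>"
  shows "(\<lambda>n. C * (real n + 1) ^ e / \<rho> ^ n) \<longlonglongrightarrow> 0"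
  using tendsto_mult_left[OF summable_LIMSEQ_zero[OF summable_poly_over_exp[OF assms, of e]], of C] by simp

lemma uniform_limit_rate:
  fixes \<rho> :: real and r :: "nat \<Rightarrow> 'a \<Rightarrow> real"
  assumes "1 < \<rho>" "\<And>n x. x \<in> S \<Longrightarrow> \<bar>g x - r n x\<bar> \<le> C * (real n + 1) ^ e / \<rho> ^ n"
  shows "uniform_limit S r g sequentially"
proof (rule uniform_limitI)
  fix \<epsilon> :: real assume "0 < \<epsilon>"
  then have "\<forall>\<^sub>F n in sequentially. C * (real n + 1) ^ e / \<rho> ^ n < \<epsilon>"
    using approx_rate_tendsto_0[OF assms(1)] by (auto dest: order_tendstoD)
  then show "\<forall>\<^sub>F n in sequentially. \<forall>x\<in>S. dist (r n x) (g x) < \<epsilon>"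
  proof eventually_elim
    case (elim n)
    show ?case
    proof
      fix x assume "x \<in> S"
      then show "dist (r n x) (g x) < \<epsilon>"
        using assms(2)[of x n] elim by (simp add: dist_real_def abs_minus_commute)
    qed
  qed
qed

lemma approx_rate_continuous:
  assumes "1 < \<rho>" "approx_rate \<rho> e g r"
  shows "continuous_on cube g"
proof -
  obtain C where "\<And>n x. x \<in> cube \<Longrightarrow> \<bar>g x - r n x\<bar> \<le> C * (real n + 1) ^ e / \<rho> ^ n"
    using assms(2) by (auto simp: approx_rate_def)
  then have "uniform_limit cube r g sequentially" by (rule uniform_limit_rate[OF assms(1)])
  moreover have "\<forall>\<^sub>F n in sequentially. continuous_on cube (r n)"
    using assms(2) unfolding approx_rate_def
    by (intro always_eventually allI) (blast intro: cube_poly_continuous)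
  ultimately show ?thesis by (intro uniform_limit_theorem[of cube r]) auto
qed

text \<open>The increments of the approximating sequence are polynomials, so Markov's inequality bounds the increments of
their partial derivatives at the price of two more powers of \<open>n\<close>. Hence these derivatives converge
uniformly, and differentiation along lines commutes with the limit.\<close>
lemma approx_rate_partial:
  fixes g :: "real ^ 'm::finite \<Rightarrow> real"
  assumes \<rho>: "1 < \<rho>" and "approx_rate \<rho> e g r"
  shows "approx_rate \<rho> (e + 2) (partial i g) (\<lambda>n. partial i (r n))"
    and "x \<in> cube \<Longrightarrow> (coord_line i g x has_vector_derivative partial i g x) (at (x $ i) within {-1..1})"
proof -
  obtain C where cp: "\<And>n. cube_poly n (r n)"
    and C: "\<And>n x. x \<in> cube \<Longrightarrow> \<bar>g x - r n x\<bar> \<le> C * (real n + 1) ^ e / \<rho> ^ n"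
    using assms(2) by (auto simp: approx_rate_def)
  have C0: "0 \<le> C" using order.trans[OF abs_ge_zero C[OF zero_in_cube, of 0]] by simp
  define D where "D = C * (1 + 2 ^ e)"
  define M where "M = (\<lambda>j. D * (real j + 1) ^ e / \<rho> ^ j)"
  have step: "\<bar>r (Suc j) x - r j x\<bar> \<le> M j" if "x \<in> cube" for j x
  proof -
    have "(real (Suc j) + 1) ^ e \<le> (2 * (real j + 1)) ^ e" by (intro power_mono) auto
    then have "C * (real (Suc j) + 1) ^ e / \<rho> ^ Suc j \<le> C * (2 * (real j + 1)) ^ e / \<rho> ^ j"
      using C0 \<rho> by (intro frac_le mult_left_mono) auto
    then have "\<bar>g x - r (Suc j) x\<bar> \<le> C * 2 ^ e * (real j + 1) ^ e / \<rho> ^ j"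
      using order.trans[OF C[OF that, of "Suc j"]] unfolding power_mult_distrib mult.assoc by blast
    then have "\<bar>r (Suc j) x - r j x\<bar> \<le> C * (real j + 1) ^ e / \<rho> ^ j + C * 2 ^ e * (real j + 1) ^ e / \<rho> ^ j"
      using C[OF that, of j] by linarith
    also have "\<dots> = M j" by (simp add: M_def D_def algebra_simps add_divide_distrib)
    finally show ?thesis .
  qed
  define s where "s = (\<lambda>n. partial i (r n))"
  define K where "K = 2 * D"
  have incr: "\<bar>s (Suc j) x - s j x\<bar> \<le> K * (real j + 1) ^ (e + 2) / \<rho> ^ j" if x: "x \<in> cube" for j x
  proof -
    have cpd: "cube_poly (Suc j) (\<lambda>x. r (Suc j) x - r j x)"
      by (rule cube_poly_diff[OF cp cube_poly_mono[OF cp]]) simp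
    have "partial i (\<lambda>x. r (Suc j) x - r j x) x = s (Suc j) x - s j x"
      using partial_sum[of UNIV "\<lambda>b. if b then r (Suc j) else r j" "\<lambda>x. r (Suc j) x - r j x" "\<lambda>b. if b then 1 else -1" x i]
        cube_poly_smooth[OF cp] x by (simp add: UNIV_bool s_def)
    then have "\<bar>s (Suc j) x - s j x\<bar> \<le> 2 * (real (Suc j))\<^sup>2 * M j"
      using cube_poly_partial(3)[OF cpd step x, of i] by simp
    also have "\<dots> = K * (real j + 1) ^ (e + 2) / \<rho> ^ j"
      by (simp add: M_def K_def power_add power2_eq_square mult_ac add.commute)
    finally show ?thesis .
  qed
  define h where "h = (\<lambda>x. lim (\<lambda>n. s n x))"
  define C' where "C' = K * (\<Sum>j. (real j + 1) ^ (e + 2) / \<rho> ^ j)"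
  have h: "\<bar>h x - s n x\<bar> \<le> C' * (real n + 1) ^ (e + 2) / \<rho> ^ n" if "x \<in> cube" for n x
    unfolding h_def C'_def using \<rho> incr[OF that] by (rule limit_rate_of_increments)
  have s_lim: "uniform_limit cube s h sequentially"
    using \<rho> h by (rule uniform_limit_rate)
  have r_lim: "uniform_limit cube r g sequentially"
    using \<rho> C by (rule uniform_limit_rate)
  have hvd: "(coord_line i g x has_vector_derivative h x) (at (x $ i) within {-1..1})" if x: "x \<in> cube" for x
  proof -
    let ?y = "\<lambda>t. \<chi> j. if j = i then t else x $ j"
    \<comment> \<open>On the line through x the derivatives converge uniformly; the limit function is then identified with g.\<close>
    have "\<exists>\<psi>. \<forall>t\<in>{-1..1}. (\<lambda>n. coord_line i (r n) x t) \<longlonglongrightarrow> \<psi> t \<and>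
        (\<psi> has_derivative (\<lambda>v. v *\<^sub>R h (?y t))) (at t within {-1..1})"
    proof (rule has_derivative_sequence)
      show "convex {-1..1::real}" by simp
      show "x $ i \<in> {-1..1}" using x by (rule cube_coord)
      show "(\<lambda>n. coord_line i (r n) x (x $ i)) \<longlonglongrightarrow> g x"
        using tendsto_uniform_limitI[OF r_lim x] by (simp add: coord_line_def)
    next
      fix n t assume t: "t \<in> {-1..1::real}"
      have "coord_line i (r n) (?y t) = coord_line i (r n) x"
        by (intro ext, unfold coord_line_def) (rule arg_cong[of _ _ "r n"], simp add: vec_eq_iff)
      then show "(coord_line i (r n) x has_derivative (\<lambda>v. v *\<^sub>R s n (?y t))) (at t within {-1..1})"
        using cube_poly_partial(2)[OF cp[of n] cube_replace_coord[OF x t, of i], of i]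
        by (simp add: s_def has_vector_derivative_def)
    next
      fix \<epsilon> :: real assume "0 < \<epsilon>"
      then have "\<forall>\<^sub>F n in sequentially. \<forall>x\<in>cube. dist (s n x) (h x) < \<epsilon>"
        by (rule uniform_limitD[OF s_lim])
      then show "\<forall>\<^sub>F n in sequentially. \<forall>t\<in>{-1..1}. \<forall>v. norm (v *\<^sub>R s n (?y t) - v *\<^sub>R h (?y t)) \<le> \<epsilon> * norm v"
      proof eventually_elim
        case (elim n)
        show ?case
        proof (intro ballI allI)
          fix t v :: real assume "t \<in> {-1..1}"
          then have "\<bar>s n (?y t) - h (?y t)\<bar> \<le> \<epsilon>"
            using elim cube_replace_coord[OF x, of t i] by (force simp: dist_real_def)
          then have "\<bar>s n (?y t) - h (?y t)\<bar> * \<bar>v\<bar> \<le> \<epsilon> * \<bar>v\<bar>" by (rule mult_right_mono) simp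
          then show "norm (v *\<^sub>R s n (?y t) - v *\<^sub>R h (?y t)) \<le> \<epsilon> * norm v"
            by (simp add: abs_mult mult.commute flip: right_diff_distrib)
        qed
      qed
    qed
    then obtain \<psi> where \<psi>: "\<And>t. t \<in> {-1..1} \<Longrightarrow> (\<lambda>n. coord_line i (r n) x t) \<longlonglongrightarrow> \<psi> t"
      "\<And>t. t \<in> {-1..1} \<Longrightarrow> (\<psi> has_derivative (\<lambda>v. v *\<^sub>R h (?y t))) (at t within {-1..1})"
      by blast
    have eq: "coord_line i g x t = \<psi> t" if t: "t \<in> {-1..1}" for t
    proof -
      have "(\<lambda>n. coord_line i (r n) x t) \<longlonglongrightarrow> coord_line i g x t"
        using tendsto_uniform_limitI[OF r_lim cube_replace_coord[OF x t, of i]]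
        by (simp add: coord_line_def)
      then show ?thesis using \<psi>(1)[OF t] by (rule LIMSEQ_unique)
    qed
    have "(\<psi> has_vector_derivative h x) (at (x $ i) within {-1..1})"
      using \<psi>(2)[OF cube_coord[OF x, of i]] by (simp add: has_vector_derivative_def)
    with cube_coord[OF x] eq show ?thesis
      by (rule has_vector_derivative_transform)
  qed
  have peq: "partial i g x = h x" if "x \<in> cube" for x
    using that hvd[OF that] by (rule partial_eqI)
  show "approx_rate \<rho> (e + 2) (partial i g) (\<lambda>n. partial i (r n))"
    unfolding approx_rate_def using h peq cp by (auto simp: s_def intro: cube_poly_partial(1))
  show "(coord_line i g x has_vector_derivative partial i g x) (at (x $ i) within {-1..1})" if "x \<in> cube"
    using hvd[OF that] peq[OF that] by simp
qed

lemma approx_rate_smooth: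
  assumes "1 < \<rho>" "approx_rate \<rho> e g r"
  shows "cube_smooth g"
proof (rule cube_smooth_coinduct[where R = "\<lambda>g. \<exists>e r. approx_rate \<rho> e g r"])
  show "\<exists>e r. approx_rate \<rho> e g r" using assms(2) by blast
next
  fix h :: "real ^ 'a \<Rightarrow> real" assume "\<exists>e r. approx_rate \<rho> e h r"
  then show "continuous_on cube h" using approx_rate_continuous[OF assms(1)] by blast
next
  fix h :: "real ^ 'a \<Rightarrow> real" and i and x :: "real ^ 'a"
  assume "\<exists>e r. approx_rate \<rho> e h r" "x \<in> cube"
  then show "coord_line i h x differentiable (at (x $ i) within {-1..1})"
    using approx_rate_partial(2)[OF assms(1)] differentiableI_vector by blast
next
  fix h :: "real ^ 'a \<Rightarrow> real" and i
  assume "\<exists>e r. approx_rate \<rho> e h r"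
  then show "\<exists>e r. approx_rate \<rho> e (partial i h) r" using approx_rate_partial(1)[OF assms(1)] by blast
qed

lemma approx_rate_mpartial:
  fixes g :: "real ^ 'm::{finite,linorder} \<Rightarrow> real"
  assumes "1 < \<rho>" "approx_rate \<rho> 0 g r"
  shows "approx_rate \<rho> (2 * (\<Sum>i\<in>UNIV. \<beta> $ i)) (mpartial \<beta> g) (\<lambda>n. mpartial \<beta> (r n))"
proof (rule mpartial_induct[where R = "\<lambda>e g r. approx_rate \<rho> (2 * e) g r"])
  show "approx_rate \<rho> (2 * 0) g r" using assms(2) by simp
  fix e i and g :: "real ^ 'm::{finite,linorder} \<Rightarrow> real" and r
  assume "approx_rate \<rho> (2 * e) g r"
  then show "approx_rate \<rho> (2 * Suc e) (partial i g) (\<lambda>n. partial i (r n))"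
    using approx_rate_partial(1)[OF assms(1), of "2 * e" g r i] by (simp add: add.commute)
qed

section \<open>The index sets and the norms\<close>

lemma coord_le_lp_norm:
  assumes "0 < p"
  shows "\<bar>x $ i\<bar> \<le> lp_norm p x"
proof (cases "p = \<infinity>")
  case True
  then show ?thesis by (simp add: lp_norm_def)
next
  case False
  define r where "r = real_of_ereal p"
  have r: "0 < r" using assms False by (cases p) (auto simp: r_def)
  have "\<bar>x $ i\<bar> = (\<bar>x $ i\<bar> powr r) powr (1 / r)" using r by (simp add: powr_powr)
  also have "\<dots> \<le> (\<Sum>i\<in>UNIV. \<bar>x $ i\<bar> powr r) powr (1 / r)"
    using r by (intro powr_mono2 member_le_sum) auto
  finally show ?thesis using False by (simp add: lp_norm_def r_def)
qed

lemma lp_norm_mono: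
  assumes "0 < p" "\<And>i. \<bar>x $ i\<bar> \<le> \<bar>y $ i\<bar>"
  shows "lp_norm p x \<le> lp_norm p y"
proof (cases "p = \<infinity>")
  case True
  have "\<bar>x $ i\<bar> \<le> lp_norm p y" for i
    using assms(2)[of i] coord_le_lp_norm[OF assms(1), of y i] by linarith
  then show ?thesis unfolding lp_norm_def[of p x] using True by simp
next
  case False
  define r where "r = real_of_ereal p"
  have r: "0 < r" using assms False by (cases p) (auto simp: r_def)
  have "(\<Sum>i\<in>UNIV. \<bar>x $ i\<bar> powr r) powr (1 / r) \<le> (\<Sum>i\<in>UNIV. \<bar>y $ i\<bar> powr r) powr (1 / r)"
    using r assms(2) by (intro powr_mono2 sum_mono sum_nonneg) auto
  then show ?thesis using False by (simp add: lp_norm_def r_def)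
qed

text \<open>Stated as an inequality since the multiples of the unit vectors are only needed as members of the index set;
they belong to it for every exponent, also below 1.\<close>
lemma lp_norm_axis:
  assumes "0 < p" "0 \<le> t"
  shows "lp_norm p (\<chi> i. if i = i0 then t else 0) \<le> t"
proof (cases "p = \<infinity>")
  case True
  then show ?thesis using assms(2) by (simp add: lp_norm_def)
next
  case False
  define r where "r = real_of_ereal p"
  have r: "0 < r" using assms False by (cases p) (auto simp: r_def)
  have "(\<Sum>i\<in>UNIV. \<bar>(\<chi> i. if i = i0 then t else 0) $ i\<bar> powr r) = (\<Sum>i\<in>UNIV. if i = i0 then t powr r else 0)"
    using assms(2) by (intro sum.cong) auto
  then have "(\<Sum>i\<in>UNIV. \<bar>(\<chi> i. if i = i0 then t else 0) $ i\<bar> powr r) powr (1 / r) = t"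
    using r assms(2) by (simp add: powr_powr)
  then show ?thesis using False by (simp add: lp_norm_def r_def)
qed

lemma index_set_downward_closed:
  assumes "0 < p"
  shows "downward_closed (index_set n p)"
  unfolding downward_closed_def index_set_def
proof (clarsimp)
  fix \<alpha> \<beta> :: "nat ^ 'a" assume "lp_norm p (\<chi> i. real (\<alpha> $ i)) \<le> real n" "\<forall>i. \<beta> $ i \<le> \<alpha> $ i"
  then show "lp_norm p (\<chi> i. real (\<beta> $ i)) \<le> real n"
    using lp_norm_mono[OF assms, of "\<chi> i. real (\<beta> $ i)" "\<chi> i. real (\<alpha> $ i)"] by simp
qed

lemma index_set_le:
  assumes "0 < p" "\<alpha> \<in> index_set n p"
  shows "\<alpha> $ i \<le> n"
  using coord_le_lp_norm[OF assms(1), of "\<chi> i. real (\<alpha> $ i)" i] assms(2) by (simp add: index_set_def)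

lemma axis_in_index_set:
  assumes "0 < p"
  shows "(\<chi> i. if i = i0 then n else 0) \<in> index_set n p"
proof -
  have "(\<chi> i. real ((\<chi> i. if i = i0 then n else 0) $ i)) = (\<chi> i. if i = i0 then real n else 0)"
    by (simp add: vec_eq_iff)
  then show ?thesis using lp_norm_axis[OF assms, of "real n" i0] by (simp add: index_set_def)
qed

lemma finite_multi_orders: "finite {\<beta> :: nat ^ 'm::finite. (\<Sum>i\<in>UNIV. \<beta> $ i) \<le> k}"
proof (rule finite_subset[OF _ finite_index_box])
  show "{\<beta> :: nat ^ 'm. (\<Sum>i\<in>UNIV. \<beta> $ i) \<le> k} \<subseteq> index_box k"
  proof (clarsimp simp: index_box_def)
    fix \<beta> :: "nat ^ 'm" and i assume "(\<Sum>i\<in>UNIV. \<beta> $ i) \<le> k"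
    then show "\<beta> $ i \<le> k" using member_le_sum[of i UNIV "\<lambda>i. \<beta> $ i"] by simp
  qed
qed

lemma mpartial_0: "mpartial 0 g = g"
  using mpartial_axis[of undefined 0 g] by (simp add: zero_vec_def)

lemma Ck_norm_0: "Ck_norm 0 g = sup_norm cube g"
proof -
  have "{\<beta> :: nat ^ 'a::{finite,linorder}. (\<Sum>i\<in>UNIV. \<beta> $ i) \<le> 0} = {0}" by (auto simp: vec_eq_iff)
  then show ?thesis by (simp add: Ck_norm_def mpartial_0)
qed

lemma lebesgue_const_deriv_0: "lebesgue_const_deriv 0 A P = lebesgue_const A P"
proof -
  have "{\<beta> :: nat ^ 'a::{finite,linorder}. (\<Sum>i\<in>UNIV. \<beta> $ i) \<le> 0} = {0}" by (auto simp: vec_eq_iff)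
  then show ?thesis by (simp add: lebesgue_const_deriv_def lebesgue_const_def mpartial_0)
qed

lemma sup_norm_le:
  assumes "\<And>x. x \<in> cube \<Longrightarrow> norm (g x) \<le> M"
  shows "sup_norm cube g \<le> M"
  unfolding sup_norm_def using zero_in_cube assms by (intro cSUP_least) auto

lemma le_sup_norm:
  fixes g :: "real ^ 'm::finite \<Rightarrow> real"
  assumes "continuous_on cube g" "x \<in> cube"
  shows "\<bar>g x\<bar> \<le> sup_norm cube g"
proof -
  have "bdd_above ((\<lambda>x. norm (g x)) ` cube)"
    using assms(1)
    by (intro bounded_imp_bdd_above compact_imp_bounded compact_continuous_image compact_cube continuous_intros)
  then show ?thesis unfolding sup_norm_def using assms(2) by (intro cSUP_upper2) auto
qed

section \<open>Bounds for the Lebesgue constants\<close>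

context interpolation_grid
begin

lemma poly_space_cube_poly: "q \<in> poly_space A \<Longrightarrow> cube_poly n q"
proof -
  have "poly_space A \<subseteq> (poly_space (index_box n) :: (real ^ 'm \<Rightarrow> real) set)"
    by (intro poly_space_mono finite_index_box) (auto simp: index_box_def le_n)
  then show "q \<in> poly_space A \<Longrightarrow> cube_poly n q" by (auto simp: cube_poly_def)
qed

lemma lagrange_cube_poly: "\<alpha> \<in> A \<Longrightarrow> cube_poly n (lagrange A P \<alpha>)"
  by (intro poly_space_cube_poly lagrange_in_poly_space)

end

text \<open>Mixed partial derivatives iterate through the coordinates in a fixed order, so they need a linearly ordered
index type.\<close>
locale ordered_interpolation_grid = interpolation_grid A P n
  for A :: "(nat ^ 'm::{finite,linorder}) set" and P :: "'m::{finite,linorder} \<Rightarrow> nat \<Rightarrow> real" and n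
begin

lemma sum_abs_le_lebesgue_const_deriv:
  assumes "x \<in> cube" "(\<Sum>i\<in>UNIV. \<beta> $ i) \<le> k"
  shows "(\<Sum>\<alpha>\<in>A. \<bar>mpartial \<beta> (lagrange A P \<alpha>) x\<bar>) \<le> lebesgue_const_deriv k A P"
proof -
  let ?s = "\<lambda>\<beta> x. \<Sum>\<alpha>\<in>A. \<bar>mpartial \<beta> (lagrange A P \<alpha>) x\<bar>"
  have bdd: "bdd_above (?s \<beta> ` cube)" for \<beta>
    using mpartial_cube_poly(1)[OF lagrange_cube_poly, THEN cube_poly_continuous]
    by (intro bounded_imp_bdd_above compact_imp_bounded compact_continuous_image compact_cube continuous_intros) auto
  have le: "?s \<beta> x \<le> (SUP x\<in>cube. ?s \<beta> x)" if "x \<in> cube" for \<beta> x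
    using bdd that by (intro cSUP_upper)
  have nonneg: "0 \<le> (SUP x\<in>cube. ?s \<beta> x)" for \<beta>
    by (rule order.trans[OF _ le[OF zero_in_cube]]) (simp add: sum_nonneg)
  have "?s \<beta> x \<le> (SUP x\<in>cube. ?s \<beta> x)" using assms(1) by (rule le)
  also have "\<dots> \<le> lebesgue_const_deriv k A P"
    unfolding lebesgue_const_deriv_def using assms(2) nonneg
    by (intro member_le_sum[of \<beta> _ "\<lambda>\<beta>. SUP x\<in>cube. ?s \<beta> x"] finite_multi_orders) auto
  finally show ?thesis .
qed

lemma lebesgue_const_deriv_nonneg: "0 \<le> lebesgue_const_deriv k A P"
  by (rule order.trans[OF _ sum_abs_le_lebesgue_const_deriv[OF zero_in_cube, of 0]]) (simp_all add: sum_nonneg)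

text \<open>At a fixed point the sum of absolute values is the derivative of a single polynomial, the combination of the
Lagrange basis with the signs of these derivatives. That polynomial is bounded by the Lebesgue constant, and
Markov's inequality applies to it.\<close>
lemma sum_abs_mpartial_lagrange_le:
  assumes "\<And>i h. h \<le> n \<Longrightarrow> lebesgue_const1 (P i) h \<le> B" "x \<in> cube"
  shows "(\<Sum>\<alpha>\<in>A. \<bar>mpartial \<beta> (lagrange A P \<alpha>) x\<bar>)
    \<le> (2 * real n ^ 2) ^ (\<Sum>i\<in>UNIV. \<beta> $ i) * ((real n + 1) ^ CARD('m) * (2 * B) ^ CARD('m))"
proof -
  \<comment> \<open>The signs depend on the chosen point, but the bound for the signed sum does not.\<close>
  define \<sigma> where "\<sigma> = (\<lambda>\<alpha>. sgn (mpartial \<beta> (lagrange A P \<alpha>) x))"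
  define g where "g = (\<lambda>x. \<Sum>\<alpha>\<in>A. \<sigma> \<alpha> * lagrange A P \<alpha> x)"
  have g: "cube_poly n g" unfolding g_def by (intro cube_poly_sum lagrange_cube_poly)
  have "\<bar>g y\<bar> \<le> (real n + 1) ^ CARD('m) * (2 * B) ^ CARD('m)" if "y \<in> cube" for y
  proof -
    have "\<bar>g y\<bar> \<le> (\<Sum>\<alpha>\<in>A. \<bar>\<sigma> \<alpha> * lagrange A P \<alpha> y\<bar>)" unfolding g_def by (rule sum_abs)
    also have "\<dots> \<le> (\<Sum>\<alpha>\<in>A. \<bar>lagrange A P \<alpha> y\<bar>)"
      by (intro sum_mono) (simp add: abs_mult \<sigma>_def abs_sgn_eq)
    also have "\<dots> \<le> (real n + 1) ^ CARD('m) * (2 * B) ^ CARD('m)"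
      using assms(1) that by (rule sum_abs_lagrange_le)
    finally show ?thesis .
  qed
  then have "\<bar>mpartial \<beta> g x\<bar> \<le> (2 * real n ^ 2) ^ (\<Sum>i\<in>UNIV. \<beta> $ i) * ((real n + 1) ^ CARD('m) * (2 * B) ^ CARD('m))"
    using assms(2) by (rule mpartial_cube_poly(2)[OF g])
  moreover have "mpartial \<beta> g x = (\<Sum>\<alpha>\<in>A. \<sigma> \<alpha> * mpartial \<beta> (lagrange A P \<alpha>) x)"
    by (rule mpartial_sum[OF cube_poly_smooth[OF lagrange_cube_poly] _ assms(2)]) (simp_all add: g_def)
  moreover have "\<dots> = (\<Sum>\<alpha>\<in>A. \<bar>mpartial \<beta> (lagrange A P \<alpha>) x\<bar>)"
    by (simp add: \<sigma>_def abs_sgn mult.commute)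
  ultimately show ?thesis by simp
qed

lemma lebesgue_const_deriv_le:
  assumes "\<And>i h. h \<le> n \<Longrightarrow> lebesgue_const1 (P i) h \<le> B" "0 \<le> B"
  shows "lebesgue_const_deriv k A P \<le> real (card {\<beta> :: nat ^ 'm::{finite,linorder}. (\<Sum>i\<in>UNIV. \<beta> $ i) \<le> k})
    * ((2 * (real n + 1) ^ 2) ^ k * ((real n + 1) ^ CARD('m) * (2 * B) ^ CARD('m)))"
  unfolding lebesgue_const_deriv_def
proof (rule sum_bounded_above)
  let ?L = "(real n + 1) ^ CARD('m) * (2 * B) ^ CARD('m)"
  fix \<beta> :: "nat ^ 'm::{finite,linorder}" assume "\<beta> \<in> {\<beta>. (\<Sum>i\<in>UNIV. \<beta> $ i) \<le> k}"
  then have k: "(\<Sum>i\<in>UNIV. \<beta> $ i) \<le> k" by simp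
  show "(SUP x\<in>cube. \<Sum>\<alpha>\<in>A. \<bar>mpartial \<beta> (lagrange A P \<alpha>) x\<bar>) \<le> (2 * (real n + 1) ^ 2) ^ k * ?L"
  proof (rule cSUP_least)
    show "(cube :: (real ^ 'm::{finite,linorder}) set) \<noteq> {}" using zero_in_cube by blast
    fix x :: "real ^ 'm::{finite,linorder}" assume "x \<in> cube"
    with assms(1) have "(\<Sum>\<alpha>\<in>A. \<bar>mpartial \<beta> (lagrange A P \<alpha>) x\<bar>) \<le> (2 * real n ^ 2) ^ (\<Sum>i\<in>UNIV. \<beta> $ i) * ?L"
      by (rule sum_abs_mpartial_lagrange_le)
    also have "\<dots> \<le> (2 * (real n + 1) ^ 2) ^ k * ?L"
    proof (rule mult_right_mono)
      have "(2 * real n ^ 2) ^ (\<Sum>i\<in>UNIV. \<beta> $ i) \<le> (2 * (real n + 1) ^ 2) ^ (\<Sum>i\<in>UNIV. \<beta> $ i)"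
        by (intro power_mono mult_left_mono) auto
      also have "\<dots> \<le> (2 * (real n + 1) ^ 2) ^ k"
      proof (rule power_increasing[OF k])
        have "1 \<le> (real n + 1) ^ 2" by (rule one_le_power) simp
        then show "1 \<le> 2 * (real n + 1) ^ 2" by linarith
      qed
      finally show "(2 * real n ^ 2) ^ (\<Sum>i\<in>UNIV. \<beta> $ i) \<le> (2 * (real n + 1) ^ 2) ^ k" .
      show "0 \<le> ?L" using assms(2) by simp
    qed
    finally show "(\<Sum>\<alpha>\<in>A. \<bar>mpartial \<beta> (lagrange A P \<alpha>) x\<bar>) \<le> (2 * (real n + 1) ^ 2) ^ k * ?L" .
  qed
qed

lemma grid_node_in_cube:
  assumes "\<And>i. P i ` {..n} \<subseteq> {-1..1}" "\<alpha> \<in> A"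
  shows "grid_node P \<alpha> \<in> cube"
  using assms(1) le_n[OF assms(2)] by (fastforce simp: cube_def grid_node_def)

text \<open>Apply reproduction to the Chebyshev polynomial in the coordinate \<open>i0\<close>, whose values at the nodes are
at most 1, and differentiate \<open>k\<close> times at the corner of the cube.\<close>
lemma chebyshev_deriv_le_lebesgue_const_deriv:
  assumes "\<And>i. P i ` {..n} \<subseteq> {-1..1}" "(\<chi> i. if i = i0 then n else 0) \<in> A"
  shows "poly ((pderiv ^^ k) (chebyshev n)) 1 \<le> lebesgue_const_deriv k A P"
proof -
  define q where "q = (\<lambda>x :: real ^ 'm::{finite,linorder}. poly (chebyshev n) (x $ i0))"
  define \<beta> :: "nat ^ 'm::{finite,linorder}" where "\<beta> = (\<chi> i. if i = i0 then k else 0)"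
  let ?one = "\<chi> i. 1 :: real ^ 'm::{finite,linorder}"
  have one: "?one \<in> cube" by (simp add: cube_def)
  have "(\<lambda>x :: real ^ 'm::{finite,linorder}. \<Prod>i\<in>UNIV. poly (if i = i0 then chebyshev n else 1) (x $ i)) \<in> poly_space A"
    by (rule tensor_poly_in_poly_space[OF down finite_index assms(2)]) (simp add: degree_chebyshev)
  moreover have "(\<Prod>i\<in>UNIV. poly (if i = i0 then chebyshev n else 1) (x $ i)) = q x" for x :: "real ^ 'm::{finite,linorder}"
  proof -
    have "(\<Prod>i\<in>UNIV. poly (if i = i0 then chebyshev n else 1) (x $ i)) = (\<Prod>i\<in>UNIV. if i = i0 then q x else 1)"
      by (intro prod.cong) (auto simp: q_def)
    then show ?thesis by simp
  qed
  ultimately have q: "q \<in> poly_space A" by simp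
  have "poly ((pderiv ^^ k) (chebyshev n)) 1 = mpartial \<beta> q ?one"
    unfolding \<beta>_def mpartial_axis q_def using funpow_partial_univariate[OF one] by simp
  also have "\<dots> = (\<Sum>\<alpha>\<in>A. q (grid_node P \<alpha>) * mpartial \<beta> (lagrange A P \<alpha>) ?one)"
    using lagrange_reproduces[OF q]
    by (intro mpartial_sum[OF cube_poly_smooth[OF lagrange_cube_poly] _ one])
  also have "\<dots> \<le> (\<Sum>\<alpha>\<in>A. \<bar>mpartial \<beta> (lagrange A P \<alpha>) ?one\<bar>)"
  proof (rule sum_mono)
    fix \<alpha> assume "\<alpha> \<in> A"
    then have "\<bar>q (grid_node P \<alpha>)\<bar> \<le> 1"
      unfolding q_def by (intro abs_chebyshev_le_1 cube_coord grid_node_in_cube assms(1))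
    then have "\<bar>q (grid_node P \<alpha>) * mpartial \<beta> (lagrange A P \<alpha>) ?one\<bar> \<le> 1 * \<bar>mpartial \<beta> (lagrange A P \<alpha>) ?one\<bar>"
      unfolding abs_mult by (rule mult_right_mono) simp
    then show "q (grid_node P \<alpha>) * mpartial \<beta> (lagrange A P \<alpha>) ?one \<le> \<bar>mpartial \<beta> (lagrange A P \<alpha>) ?one\<bar>"
      by simp
  qed
  also have "\<dots> \<le> lebesgue_const_deriv k A P"
    by (rule sum_abs_le_lebesgue_const_deriv[OF one]) (simp add: \<beta>_def)
  finally show ?thesis .
qed

text \<open>This lower bound is what allows the Lebesgue constant to absorb the Markov loss \<open>n ^ (2 * k)\<close> of the best
approximations. For \<open>n < k\<close> the Chebyshev bound is not available, but then the summand 1 suffices.\<close>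
lemma power_le_lebesgue_const_deriv:
  assumes "\<And>i. P i ` {..n} \<subseteq> {-1..1}" "(\<chi> i. if i = i0 then n else 0) \<in> A"
  shows "(real n + 1) ^ (2 * k) \<le> (8 * real k ^ 2) ^ k * (1 + lebesgue_const_deriv k A P)"
proof (cases "k = 0")
  case True
  then show ?thesis using lebesgue_const_deriv_nonneg by simp
next
  case False
  have "((real n + 1) ^ 2 / (8 * real k ^ 2)) ^ k \<le> 1 + lebesgue_const_deriv k A P"
  proof (cases "k \<le> n")
    case True
    then show ?thesis
      using chebyshev_higher_deriv_at_1_ge[of k k n] chebyshev_deriv_le_lebesgue_const_deriv[OF assms, of k] False
      by simp
  next
    case False
    then have "(real n + 1) ^ 2 \<le> real k ^ 2" by (intro power_mono) auto
    then have "(real n + 1) ^ 2 \<le> 8 * real k ^ 2" using zero_le_power2[of "real k"] by linarith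
    then have "((real n + 1) ^ 2 / (8 * real k ^ 2)) ^ k \<le> 1" using \<open>k \<noteq> 0\<close> by (intro power_le_one) auto
    then show ?thesis using lebesgue_const_deriv_nonneg[of k] by linarith
  qed
  moreover have "0 < (8 * real k ^ 2) ^ k" using False by simp
  ultimately have "((real n + 1) ^ 2) ^ k \<le> (1 + lebesgue_const_deriv k A P) * (8 * real k ^ 2) ^ k"
    by (simp only: power_divide pos_divide_le_eq)
  then show ?thesis unfolding power_mult[of _ 2 k] by (simp only: mult.commute)
qed

text \<open>Expand the interpolant and \<open>q\<close> in the Lagrange basis; the difference of their derivatives only involves the
values of \<open>f - q\<close> at the nodes.\<close>
lemma mpartial_interpolation_error:
  assumes "\<And>i. P i ` {..n} \<subseteq> {-1..1}" "cube_smooth f" "q \<in> poly_space A"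
    "\<And>x. x \<in> cube \<Longrightarrow> \<bar>f x - q x\<bar> \<le> \<epsilon>" "x \<in> cube" "(\<Sum>i\<in>UNIV. \<beta> $ i) \<le> k"
  shows "\<bar>mpartial \<beta> (\<lambda>x. f x - interpolant A P f x) x\<bar>
    \<le> \<bar>mpartial \<beta> f x - mpartial \<beta> q x\<bar> + \<epsilon> * lebesgue_const_deriv k A P"
proof -
  let ?Q = "interpolant A P f"
  let ?L = "\<lambda>\<alpha>. mpartial \<beta> (lagrange A P \<alpha>) x"
  have smooth: "\<And>\<alpha>. \<alpha> \<in> A \<Longrightarrow> cube_smooth (lagrange A P \<alpha>)"
    by (rule cube_poly_smooth[OF lagrange_cube_poly])
  have eps: "0 \<le> \<epsilon>" using order.trans[OF abs_ge_zero assms(4)[OF assms(5)]] .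
  have Q: "?Q = (\<lambda>x. \<Sum>\<alpha>\<in>A. f (grid_node P \<alpha>) * lagrange A P \<alpha> x)"
    by (rule ext) (rule interpolant_eq)
  have "cube_poly n ?Q" unfolding Q by (intro cube_poly_sum lagrange_cube_poly)
  then have "mpartial \<beta> (\<lambda>x. f x - ?Q x) x = mpartial \<beta> f x - mpartial \<beta> ?Q x"
    by (intro mpartial_diff[OF assms(2) cube_poly_smooth assms(5)])
  also have "mpartial \<beta> ?Q x = (\<Sum>\<alpha>\<in>A. f (grid_node P \<alpha>) * ?L \<alpha>)"
    by (rule mpartial_sum[OF smooth _ assms(5)]) (simp_all add: Q)
  also have "mpartial \<beta> f x - (\<Sum>\<alpha>\<in>A. f (grid_node P \<alpha>) * ?L \<alpha>)
      = (mpartial \<beta> f x - mpartial \<beta> q x) - (\<Sum>\<alpha>\<in>A. (f (grid_node P \<alpha>) - q (grid_node P \<alpha>)) * ?L \<alpha>)"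
  proof -
    have "mpartial \<beta> q x = (\<Sum>\<alpha>\<in>A. q (grid_node P \<alpha>) * ?L \<alpha>)"
      using lagrange_reproduces[OF assms(3)] by (intro mpartial_sum[OF smooth _ assms(5)])
    then show ?thesis by (simp add: left_diff_distrib sum_subtractf)
  qed
  finally have "\<bar>mpartial \<beta> (\<lambda>x. f x - ?Q x) x\<bar> \<le> \<bar>mpartial \<beta> f x - mpartial \<beta> q x\<bar>
      + \<bar>\<Sum>\<alpha>\<in>A. (f (grid_node P \<alpha>) - q (grid_node P \<alpha>)) * ?L \<alpha>\<bar>" by simp
  moreover have "\<bar>\<Sum>\<alpha>\<in>A. (f (grid_node P \<alpha>) - q (grid_node P \<alpha>)) * ?L \<alpha>\<bar> \<le> \<epsilon> * lebesgue_const_deriv k A P"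
  proof -
    have "\<bar>\<Sum>\<alpha>\<in>A. (f (grid_node P \<alpha>) - q (grid_node P \<alpha>)) * ?L \<alpha>\<bar> \<le> (\<Sum>\<alpha>\<in>A. \<epsilon> * \<bar>?L \<alpha>\<bar>)"
      by (rule order.trans[OF sum_abs])
        (auto intro!: sum_mono mult_right_mono assms(4) grid_node_in_cube assms(1) simp: abs_mult)
    also have "\<dots> \<le> \<epsilon> * lebesgue_const_deriv k A P"
      unfolding sum_distrib_left[symmetric]
      using eps sum_abs_le_lebesgue_const_deriv[OF assms(5,6)] by (intro mult_left_mono)
    finally show ?thesis .
  qed
  ultimately show ?thesis by linarith
qed

end

section \<open>The approximation error of the interpolants\<close>

text \<open>Both parts of the error have the size claimed: the part from the Lagrange basis by definition of the Lebesgue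
constant, the part from the derivatives of \<open>f - r n\<close> because its loss \<open>(n + 1) ^ (2 * k)\<close> is a lower bound for that
constant, up to a factor.\<close>
lemma Ck_interpolation_error:
  fixes f :: "real ^ 'm::{finite,linorder} \<Rightarrow> real" and P :: "nat \<Rightarrow> 'm::{finite,linorder} \<Rightarrow> nat \<Rightarrow> real"
  assumes grid: "\<And>n. ordered_interpolation_grid (A n) (P n) n"
    and nodes: "\<And>n i. P n i ` {..n} \<subseteq> {-1..1}"
    and axis: "\<And>n i. (\<chi> j. if j = i then n else 0) \<in> A n"
    and \<rho>: "1 < \<rho>"
    and r: "\<And>n. r n \<in> poly_space (A n)"
    and C: "\<And>n x. x \<in> cube \<Longrightarrow> \<bar>f x - r n x\<bar> \<le> C / \<rho> ^ n"
  shows "cube_smooth f"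
    and "\<exists>C. \<forall>n. Ck_norm k (\<lambda>x. f x - interpolant (A n) (P n) f x)
       \<le> C * ((1 + lebesgue_const_deriv k (A n) (P n)) / \<rho> ^ n)"
proof -
  have "cube_poly n (r n)" for n
    using interpolation_grid.poly_space_cube_poly[OF ordered_interpolation_grid.axioms[OF grid] r] .
  then have rate: "approx_rate \<rho> 0 f r" unfolding approx_rate_def using C by auto
  show smooth: "cube_smooth f" using \<rho> rate by (rule approx_rate_smooth)
  let ?I = "{\<beta> :: nat ^ 'm::{finite,linorder}. (\<Sum>i\<in>UNIV. \<beta> $ i) \<le> k}"
  let ?\<Lambda> = "\<lambda>n. lebesgue_const_deriv k (A n) (P n)"
  have "\<forall>\<beta>. \<exists>D. \<forall>n. \<forall>x\<in>cube. \<bar>mpartial \<beta> f x - mpartial \<beta> (r n) x\<bar>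
      \<le> D * (real n + 1) ^ (2 * (\<Sum>i\<in>UNIV. \<beta> $ i)) / \<rho> ^ n"
    using approx_rate_mpartial[OF \<rho> rate] unfolding approx_rate_def by blast
  from choice[OF this] obtain D where D: "\<And>\<beta> n x. x \<in> cube \<Longrightarrow>
    \<bar>mpartial \<beta> f x - mpartial \<beta> (r n) x\<bar> \<le> D \<beta> * (real n + 1) ^ (2 * (\<Sum>i\<in>UNIV. \<beta> $ i)) / \<rho> ^ n"
    by blast
  have D0: "0 \<le> D \<beta>" for \<beta>
    using order.trans[OF abs_ge_zero D[OF zero_in_cube, of \<beta> 0]] by simp
  have C0: "0 \<le> C" using order.trans[OF abs_ge_zero C[OF zero_in_cube, of 0]] by simp
  \<comment> \<open>The constant with which the Lebesgue constant absorbs the polynomial loss.\<close>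
  define c where "c = (8 * real k ^ 2) ^ k"
  have "Ck_norm k (\<lambda>x. f x - interpolant (A n) (P n) f x) \<le> (\<Sum>\<beta>\<in>?I. D \<beta> * c + C) * ((1 + ?\<Lambda> n) / \<rho> ^ n)" for n
    unfolding Ck_norm_def sum_distrib_right
  proof (rule sum_mono, rule sup_norm_le)
    interpret ordered_interpolation_grid "A n" "P n" n by (rule grid)
    fix \<beta> :: "nat ^ 'm::{finite,linorder}" and x :: "real ^ 'm::{finite,linorder}" assume "\<beta> \<in> ?I" and x: "x \<in> cube"
    then have k: "(\<Sum>i\<in>UNIV. \<beta> $ i) \<le> k" by simp
    have "\<bar>mpartial \<beta> (\<lambda>x. f x - interpolant (A n) (P n) f x) x\<bar>
        \<le> \<bar>mpartial \<beta> f x - mpartial \<beta> (r n) x\<bar> + C / \<rho> ^ n * ?\<Lambda> n"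
      by (rule mpartial_interpolation_error[OF nodes smooth r C x k])
    also have "\<dots> \<le> D \<beta> * (c * (1 + ?\<Lambda> n)) / \<rho> ^ n + C / \<rho> ^ n * (1 + ?\<Lambda> n)"
    proof (rule add_mono)
      have "(real n + 1) ^ (2 * (\<Sum>i\<in>UNIV. \<beta> $ i)) \<le> (real n + 1) ^ (2 * k)"
        using k by (intro power_increasing) auto
      also have "\<dots> \<le> c * (1 + ?\<Lambda> n)"
        unfolding c_def by (rule power_le_lebesgue_const_deriv[OF nodes axis])
      finally have "D \<beta> * (real n + 1) ^ (2 * (\<Sum>i\<in>UNIV. \<beta> $ i)) / \<rho> ^ n \<le> D \<beta> * (c * (1 + ?\<Lambda> n)) / \<rho> ^ n"
        using D0 \<rho> by (intro divide_right_mono mult_left_mono) auto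
      then show "\<bar>mpartial \<beta> f x - mpartial \<beta> (r n) x\<bar> \<le> D \<beta> * (c * (1 + ?\<Lambda> n)) / \<rho> ^ n"
        using D[OF x, of \<beta> n] by linarith
      show "C / \<rho> ^ n * ?\<Lambda> n \<le> C / \<rho> ^ n * (1 + ?\<Lambda> n)"
        using C0 \<rho> by (intro mult_left_mono) auto
    qed
    also have "\<dots> = (D \<beta> * c + C) * ((1 + ?\<Lambda> n) / \<rho> ^ n)"
      by (simp add: algebra_simps add_divide_distrib)
    finally show "norm (mpartial \<beta> (\<lambda>x. f x - interpolant (A n) (P n) f x) x)
        \<le> (D \<beta> * c + C) * ((1 + ?\<Lambda> n) / \<rho> ^ n)" by simp
  qed
  then show "\<exists>C. \<forall>n. Ck_norm k (\<lambda>x. f x - interpolant (A n) (P n) f x) \<le> C * ((1 + ?\<Lambda> n) / \<rho> ^ n)"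
    by blast
qed

text \<open>Lowering the base from \<open>\<rho>\<close> to \<open>\<rho> - \<epsilon>\<close> gains a geometric factor, which beats any power of \<open>n\<close>.\<close>
lemma O_eps_of_polynomial_factor:
  assumes "1 < \<rho>" "\<And>n. 0 \<le> a n" "\<And>n. a n \<le> c * (real n + 1) ^ E"
  shows "O_eps \<rho> (\<lambda>n. a n * \<rho> powr - real n)"
  unfolding O_eps_def
proof (intro allI impI)
  fix \<epsilon> assume \<epsilon>: "0 < \<epsilon> \<and> \<epsilon> < \<rho>"
  \<comment> \<open>The gain per step when the base is lowered.\<close>
  define \<tau> where "\<tau> = \<rho> / (\<rho> - \<epsilon>)"
  have \<tau>: "1 < \<tau>" using \<epsilon> by (simp add: \<tau>_def)
  have "convergent (\<lambda>n. c * (real n + 1) ^ E / \<tau> ^ n)"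
    using approx_rate_tendsto_0[OF \<tau>] by (rule convergentI)
  from convergent_imp_Bseq[OF this] obtain K where "\<forall>n. norm (c * (real n + 1) ^ E / \<tau> ^ n) \<le> K"
    by (rule BseqE)
  then have K: "c * (real n + 1) ^ E / \<tau> ^ n \<le> K" for n
    by (metis abs_ge_self order.trans real_norm_def)
  have "norm (a n * \<rho> powr - real n) \<le> K * norm ((\<rho> - \<epsilon>) powr - real n)" for n
  proof -
    have "a n * \<rho> powr - real n \<le> c * (real n + 1) ^ E * \<rho> powr - real n"
      using assms(3) by (rule mult_right_mono) simp
    also have "\<dots> = (c * (real n + 1) ^ E / \<tau> ^ n) * (\<rho> - \<epsilon>) powr - real n"
      using \<epsilon> assms(1) by (simp add: powr_minus powr_realpow \<tau>_def power_divide field_simps)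
    also have "\<dots> \<le> K * (\<rho> - \<epsilon>) powr - real n"
      using K[of n] by (intro mult_right_mono) auto
    finally show ?thesis using assms(2)[of n] by (simp add: abs_mult)
  qed
  then show "(\<lambda>n. a n * \<rho> powr - real n) \<in> O(\<lambda>n. (\<rho> - \<epsilon>) powr - real n)"
    by (intro bigoI always_eventually allI)
qed

theorem theorem7:
  fixes p :: ereal
    and f :: "real ^ 'm::{finite,linorder} \<Rightarrow> real"
    and pstar :: "nat \<Rightarrow> real ^ 'm::{finite,linorder} \<Rightarrow> real"
    and \<rho> \<theta> :: real
    and P :: "nat \<Rightarrow> 'm::{finite,linorder} \<Rightarrow> nat \<Rightarrow> real"
  assumes "0 < p"
    and "BLT_function p f"
    and "1 < \<rho>"
    and "\<And>n. best_approx (index_set n p) f (pstar n)"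
    and "lesssim (\<lambda>n. sup_norm cube (\<lambda>x. f x - pstar n x)) (\<lambda>n. \<rho> powr - real n)"
    and "1 \<le> \<theta>"
    and "\<And>n i. P n i ` {..n} \<subseteq> {-1..1}"
    and "\<And>n i. inj_on (P n i) {..n}"
    and "\<And>n h i. h \<le> n \<Longrightarrow> lebesgue_const1 (P n i) h \<le> (real n + 1) powr \<theta>"
  shows
    "lesssim (\<lambda>n. sup_norm cube (\<lambda>x. f x - interpolant (index_set n p) (P n) f x))
             (\<lambda>n. (1 + lebesgue_const (index_set n p) (P n)) * \<rho> powr - real n)
     \<and> O_eps \<rho> (\<lambda>n. (1 + lebesgue_const (index_set n p) (P n)) * \<rho> powr - real n)
     \<and> (\<forall>k. Ck_on_cube k f
          \<and> lesssim (\<lambda>n. Ck_norm k (\<lambda>x. f x - interpolant (index_set n p) (P n) f x))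
                    (\<lambda>n. (1 + lebesgue_const_deriv k (index_set n p) (P n)) * \<rho> powr - real n)
          \<and> O_eps \<rho> (\<lambda>n. (1 + lebesgue_const_deriv k (index_set n p) (P n)) * \<rho> powr - real n))"
proof -
  let ?A = "\<lambda>n. index_set n p :: (nat ^ 'm::{finite,linorder}) set"
  let ?\<Lambda> = "\<lambda>k n. lebesgue_const_deriv k (?A n) (P n)"
  have grid: "ordered_interpolation_grid (?A n) (P n) n" for n
    using index_set_downward_closed[OF assms(1)] index_set_le[OF assms(1)] assms(8)
    by unfold_locales auto
  have \<rho>n: "\<rho> powr - real n = 1 / \<rho> ^ n" for n
    using assms(3) by (simp add: powr_minus powr_realpow divide_inverse)
  have r: "pstar n \<in> poly_space (?A n)" for n
    using assms(4) by (simp add: best_approx_def)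
  obtain C where C: "\<And>n. sup_norm cube (\<lambda>x. f x - pstar n x) \<le> C * \<rho> powr - real n"
    using assms(5) by (auto simp: lesssim_def)
  have rate: "\<bar>f x - pstar n x\<bar> \<le> C / \<rho> ^ n" if "x \<in> cube" for n x
  proof -
    have "continuous_on cube (pstar n)"
      using interpolation_grid.poly_space_cube_poly[OF ordered_interpolation_grid.axioms[OF grid] r]
      by (rule cube_poly_continuous)
    moreover have "continuous_on cube f" using assms(2) by (simp add: BLT_function_def)
    ultimately have "\<bar>f x - pstar n x\<bar> \<le> sup_norm cube (\<lambda>x. f x - pstar n x)"
      using that by (intro le_sup_norm[where g = "\<lambda>x. f x - pstar n x"] continuous_on_diff)
    then show ?thesis using C[of n] by (simp add: \<rho>n)
  qed
  note core = Ck_interpolation_error[OF grid assms(7) axis_in_index_set[OF assms(1)] assms(3) r rate]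
  have bound: "lesssim (\<lambda>n. Ck_norm k (\<lambda>x. f x - interpolant (?A n) (P n) f x)) (\<lambda>n. (1 + ?\<Lambda> k n) * \<rho> powr - real n)" for k
    unfolding lesssim_def \<rho>n using core(2)[of k] by simp
  have small: "O_eps \<rho> (\<lambda>n. (1 + ?\<Lambda> k n) * \<rho> powr - real n)" for k
  proof (rule O_eps_of_polynomial_factor[OF assms(3)])
    \<comment> \<open>Rounding the exponent up turns the hypothesis into a bound by a natural power.\<close>
    let ?m = "CARD('m)"
    define t where "t = nat \<lceil>\<theta>\<rceil>"
    define N where "N = real (card {\<beta> :: nat ^ 'm::{finite,linorder}. (\<Sum>i\<in>UNIV. \<beta> $ i) \<le> k})"
    fix n
    interpret ordered_interpolation_grid "?A n" "P n" n by (rule grid)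
    show "0 \<le> 1 + ?\<Lambda> k n" using lebesgue_const_deriv_nonneg[of k] by simp
    have n1: "1 \<le> real n + 1" by simp
    have "(real n + 1) powr \<theta> \<le> (real n + 1) powr real t"
      unfolding t_def by (intro powr_mono n1 real_nat_ceiling_ge)
    then have "lebesgue_const1 (P n i) h \<le> (real n + 1) ^ t" if "h \<le> n" for i h
      using assms(9)[OF that, of i] by (simp add: powr_realpow)
    then have "?\<Lambda> k n \<le> N * ((2 * (real n + 1) ^ 2) ^ k * ((real n + 1) ^ ?m * (2 * (real n + 1) ^ t) ^ ?m))"
      unfolding N_def by (rule lebesgue_const_deriv_le) simp_all
    also have "\<dots> = N * 2 ^ k * 2 ^ ?m * (real n + 1) ^ (2 * k + ?m + t * ?m)"
      unfolding power_mult_distrib power_add power_mult[symmetric] by (simp add: mult_ac)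
    finally have "?\<Lambda> k n \<le> N * 2 ^ k * 2 ^ ?m * (real n + 1) ^ (2 * k + ?m + t * ?m)" .
    moreover have "1 \<le> (real n + 1) ^ (2 * k + ?m + t * ?m)" by (rule one_le_power[OF n1])
    ultimately show "1 + ?\<Lambda> k n \<le> (1 + N * 2 ^ k * 2 ^ ?m) * (real n + 1) ^ (2 * k + ?m + t * ?m)"
      unfolding distrib_right mult_1 by linarith
  qed
  show ?thesis
    using bound[of 0] small[of 0] bound small core(1)
    by (simp add: Ck_norm_0 lebesgue_const_deriv_0 cube_smooth_def)
qed

end
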